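(* Let $(\mathcal C,\mathbb E,\mathfrak s)$ be an extriangulated category. Let $A_1\xrightarrow{f_A}A_2\xrightarrow{g_A}A_3\overset{\delta_A}{\dashrightarrow}$ and $B_1\xrightarrow{f_B}B_2\xrightarrow{g_B}B_3\overset{\delta_B}{\dashrightarrow}$ be $\mathbb E$-triangles and let $i_1:A_1\to B_1$ and $i_3:A_3\to B_3$ be $\mathbb E$-inflations such that $(i_1)_*\delta_A=(i_3)^*\delta_B$. Then there is an $\mathbb E$-inflation $i_2:A_2\to B_2$ such that $(i_1,i_2,i_3)$ is a homotopic morphism of $\mathbb E$-triangles, and there is a $3\times3$ diagram $$\begin{array}{ccccccc}A_1&\xrightarrow{f_A}&A_2&\xrightarrow{g_A}&A_3&\overset{\delta_A}{\dashrightarrow}\\ {\scriptstyle i_1}\downarrow&&{\scriptstyle i_2}\downarrow&&{\scriptstyle i_3}\downarrow\\ B_1&\xrightarrow{f_B}&B_2&\xrightarrow{g_B}&B_3&\overset{\delta_B}{\dashrightarrow}\\ {\scriptstyle p_1}\downarrow&&{\scriptstyle p_2}\downarrow&&{\scriptstyle p_3}\downarrow\\ C_1&\xrightarrow{f_C}&C_2&\xrightarrow{g_C}&C_3&\overset{\delta_C}{\dashrightarrow}\end{array}$$ whose first two rows are the given $\mathbb E$-triangles and whose columns are $\mathbb E$-triangles $A_j\xrightarrow{i_j}B_j\xrightarrow{p_j}C_j\overset{\varepsilon_j}{\dashrightarrow}$ ($j=1,2,3$). In particular, if $i_1$ factors through $f_A$ and $\delta_B=0$, then the $3\times3$ diagram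 is of the form $$\begin{array}{ccccccc}A_1&\xrightarrow{f_A}&A_2&\xrightarrow{g_A}&A_3&\overset{\delta_A}{\dashrightarrow}\\ {\scriptstyle i_1}\downarrow&&{\scriptstyle i_2}\downarrow&&{\scriptstyle i_3}\downarrow\\ B_1&\xrightarrow{\left(\begin{smallmatrix}1\\0\end{smallmatrix}\right)}&B_1\oplus B_3&\xrightarrow{(0,1)}&B_3&\overset{0}{\dashrightarrow}\\ {\scriptstyle p_1}\downarrow&&{\scriptstyle p_2}\downarrow&&{\scriptstyle p_3}\downarrow\\ C_1&\xrightarrow{f_C}&C_2&\xrightarrow{g_C}&C_3&\overset{\delta_C}{\dashrightarrow}\end{array}$$ with columns the $\mathbb E$-triangles $A_1\xrightarrow{i_1}B_1\xrightarrow{p_1}C_1\overset{\varepsilon_1}{\dashrightarrow}$, $A_2\xrightarrow{i_2}B_1\oplus B_3\xrightarrow{p_2}C_2\overset{\varepsilon_2}{\dashrightarrow}$ and $A_3\xrightarrow{i_3}B_3\xrightarrow{p_3}C_3\overset{\varepsilon_3}{\dashrightarrow}$.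
   Context: Extriangulated categories (Nakaoka–Palu). Let $\mathcal C$ be an additive category and $\mathbb E:\mathcal C^{\mathrm{op}}\times\mathcal C\to\mathbf{Ab}$ an additive bifunctor. An element $\delta\in\mathbb E(Z,X)$ is an $\mathbb E$-extension; write $f_*=\mathbb E(-,f)$ and $g^*=\mathbb E(g,-)$. Two sequences $X\to Y\to Z$ and $X\to Y'\to Z$ are equivalent if there is an isomorphism $Y\cong Y'$ compatible with the maps from $X$ and to $Z$. An additive realization $\mathfrak s$ assigns to each $\delta\in\mathbb E(Z,X)$ an equivalence class $\mathfrak s(\delta)=[X\xrightarrow{f}Y\xrightarrow{g}Z]$ such that: (i) if $\delta\in\mathbb E(Z,X)$, $\delta'\in\mathbb E(Z',X')$, $\alpha:X\to X'$, $\gamma:Z\to Z'$ satisfy $\alpha_*\delta=\gamma^*\delta'$, then for any representatives $X\xrightarrow{f}Y\xrightarrow{g}Z$ of $\mathfrak s(\delta)$ and $X'\xrightarrow{f'}Y'\xrightarrow{g'}Z'$ of $\mathfrak s(\delta')$ there is $\beta:Y\to Y'$ with $\beta f=f'\alpha$, $g'\beta=\gamma g$; (ii) $0\in\mathbb E(Z,X)$ is realized by the split sequence $X\to X\oplus Z\to Z$; (iii) $\mathfrak s(\delta\oplus\delta')=\mathfrak s(\delta)\oplus\mathfrak s(\delta')$. If $\mathfrak s(\delta)=[X\xrightarrow{f}Y\xrightarrow{g}Z]$, one writes $X\xrightarrow{f}Y\xrightarrow{g}Z\overset{\delta}{\dashrightarrow}$ and calls it an $\mathbb E$-triangle, $f$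 an $\mathbb E$-inflation, $g$ an $\mathbb E$-deflation. A morphism of $\mathbb E$-triangles from this one to $X'\xrightarrow{f'}Y'\xrightarrow{g'}Z'\overset{\delta'}{\dashrightarrow}$ is a triple $(\alpha,\beta,\gamma)$ with $\beta f=f'\alpha$, $g'\beta=\gamma g$, $\alpha_*\delta=\gamma^*\delta'$. $(\mathcal C,\mathbb E,\mathfrak s)$ is an extriangulated category if moreover: (ET3) for two such $\mathbb E$-triangles and $\alpha,\beta$ with $\beta f=f'\alpha$ there is $\gamma$ making $(\alpha,\beta,\gamma)$ a morphism of $\mathbb E$-triangles; (ET3$^{\mathrm{op}}$) given $\beta,\gamma$ with $\gamma g=g'\beta$ there is $\alpha$ making $(\alpha,\beta,\gamma)$ a morphism of $\mathbb E$-triangles; (ET4) given $\mathbb E$-triangles $A\xrightarrow{f}B\xrightarrow{g}D\overset{\delta}{\dashrightarrow}$ and $B\xrightarrow{u}C\xrightarrow{v}E\overset{\varepsilon}{\dashrightarrow}$ there are $\mathbb E$-triangles $A\xrightarrow{m}C\xrightarrow{h}F\overset{\theta}{\dashrightarrow}$ and $D\xrightarrow{w}F\xrightarrow{q}E\overset{\eta}{\dashrightarrow}$ with $m=uf$, $wg=hu$, $v=qh$, $w^*\theta=\delta$, $g_*\varepsilon=\eta$, $f_*\theta=q^*\varepsilon$; (ET4$^{\mathrm{op}}$) conversely, given the latter two $\mathbb E$-triangles there are $\mathbb E$-triangles of the former form satisfying the same six relations. Homotopic morphisms. A morphism $(\alpha,\beta,\gamma)$ of $\mathbb E$-triangles from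 $X\xrightarrow{f}Y\xrightarrow{g}Z\overset{\delta}{\dashrightarrow}$ to $X'\xrightarrow{f'}Y'\xrightarrow{g'}Z'\overset{\delta'}{\dashrightarrow}$ is homotopic if there are an $\mathbb E$-triangle $X'\xrightarrow{s}E\xrightarrow{t}Z\overset{\eta}{\dashrightarrow}$ and morphisms $\beta_1:Y\to E$, $\beta_2:E\to Y'$ with $\beta=\beta_2\beta_1$, such that $(\alpha,\beta_1,1_Z)$ (from the first $\mathbb E$-triangle to this one) and $(1_{X'},\beta_2,\gamma)$ (from this one to the second) are morphisms of $\mathbb E$-triangles, and $X\xrightarrow{\left(\begin{smallmatrix}f\\ \alpha\end{smallmatrix}\right)}Y\oplus X'\xrightarrow{(\beta_1,-s)}E\overset{t^*\delta}{\dashrightarrow}$ and $E\xrightarrow{\left(\begin{smallmatrix}-t\\ \beta_2\end{smallmatrix}\right)}Z\oplus Y'\xrightarrow{(\gamma,g')}Z'\overset{s_*\delta'}{\dashrightarrow}$ are $\mathbb E$-triangles. A $3\times3$ diagram is a diagram consisting of six $\mathbb E$-triangles: three rows $A_1\xrightarrow{f_A}A_2\xrightarrow{g_A}A_3\overset{\delta_A}{\dashrightarrow}$, $B_1\xrightarrow{f_B}B_2\xrightarrow{g_B}B_3\overset{\delta_B}{\dashrightarrow}$, $C_1\xrightarrow{f_C}C_2\xrightarrow{g_C}C_3\overset{\delta_C}{\dashrightarrow}$ and three columns $A_j\xrightarrow{i_j}B_j\xrightarrow{p_j}C_j\overset{\varepsilon_j}{\dashrightarrow}$ ($j=1,2,3$),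 such that $(i_1,i_2,i_3)$ (row $A$ to row $B$), $(p_1,p_2,p_3)$ (row $B$ to row $C$), $(f_A,f_B,f_C)$ (column 1 to column 2) and $(g_A,g_B,g_C)$ (column 2 to column 3) are morphisms of $\mathbb E$-triangles. *)

theory Defs
  imports "HOL-Algebra.Ring"
begin

section \<open>Additive categories\<close>

text \<open>
  Morphism and extension groups are HOL-Algebra structures of type \<open>_ ring\<close> in which only the
  additive part (\<^const>\<open>abelian_group\<close>) is used; the multiplicative fields carry no meaning.
  Composition and the actions \<open>push\<close>, \<open>pull\<close> below are single functions on the types of
  morphisms and extensions, constrained only on the carriers. Hom-groups (and extension groups)
  for different objects are not required to be disjoint, so objects are always given explicitly.
  A choice of binary biproducts is part of the structure; it is arbitrary, and the realizations
  below are closed under isomorphism of the middle term.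
\<close>

record ('o, 'm) add_cat =
  Ob :: "'o set"
  Hom :: "'o \<Rightarrow> 'o \<Rightarrow> 'm ring"
  Idm :: "'o \<Rightarrow> 'm"
  Cmp :: "'m \<Rightarrow> 'm \<Rightarrow> 'm"  (infixr \<open>\<cdot>\<index>\<close> 75)
  Bip :: "'o \<Rightarrow> 'o \<Rightarrow> 'o"  (infixr \<open>\<boxplus>\<index>\<close> 70)
  in1 :: "'o \<Rightarrow> 'o \<Rightarrow> 'm"
  in2 :: "'o \<Rightarrow> 'o \<Rightarrow> 'm"
  pr1 :: "'o \<Rightarrow> 'o \<Rightarrow> 'm"
  pr2 :: "'o \<Rightarrow> 'o \<Rightarrow> 'm"

abbreviation mors :: "('o, 'm, 'x) add_cat_scheme \<Rightarrow> 'o \<Rightarrow> 'o \<Rightarrow> 'm set"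
  where "mors \<C> X Y \<equiv> carrier (Hom \<C> X Y)"

definition iso_mor :: "('o, 'm, 'x) add_cat_scheme \<Rightarrow> 'o \<Rightarrow> 'o \<Rightarrow> 'm \<Rightarrow> bool"
  where "iso_mor \<C> X Y f \<longleftrightarrow> f \<in> mors \<C> X Y \<and>
    (\<exists>g \<in> mors \<C> Y X. g \<cdot>\<^bsub>\<C>\<^esub> f = Idm \<C> X \<and> f \<cdot>\<^bsub>\<C>\<^esub> g = Idm \<C> Y)"

definition zero_object :: "('o, 'm, 'x) add_cat_scheme \<Rightarrow> 'o \<Rightarrow> bool"
  where "zero_object \<C> Z \<longleftrightarrow> Z \<in> Ob \<C> \<and>
    (\<forall>X \<in> Ob \<C>. (\<exists>!f. f \<in> mors \<C> Z X) \<and> (\<exists>!f. f \<in> mors \<C> X Z))"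

locale additive_category =
  fixes \<C> :: "('o, 'm, 'x) add_cat_scheme" (structure)
  assumes Idm_closed: "X \<in> Ob \<C> \<Longrightarrow> Idm \<C> X \<in> mors \<C> X X"
    and Cmp_closed: "\<lbrakk>X \<in> Ob \<C>; Y \<in> Ob \<C>; Z \<in> Ob \<C>; f \<in> mors \<C> X Y; g \<in> mors \<C> Y Z\<rbrakk>
      \<Longrightarrow> g \<cdot> f \<in> mors \<C> X Z"
    and Cmp_assoc: "\<lbrakk>W \<in> Ob \<C>; X \<in> Ob \<C>; Y \<in> Ob \<C>; Z \<in> Ob \<C>;
        f \<in> mors \<C> W X; g \<in> mors \<C> X Y; h \<in> mors \<C> Y Z\<rbrakk>
      \<Longrightarrow> (h \<cdot> g) \<cdot> f = h \<cdot> (g \<cdot> f)"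
    and Cmp_Idm: "\<lbrakk>X \<in> Ob \<C>; Y \<in> Ob \<C>; f \<in> mors \<C> X Y\<rbrakk> \<Longrightarrow> f \<cdot> Idm \<C> X = f"
    and Idm_Cmp: "\<lbrakk>X \<in> Ob \<C>; Y \<in> Ob \<C>; f \<in> mors \<C> X Y\<rbrakk> \<Longrightarrow> Idm \<C> Y \<cdot> f = f"
    and Hom_abelian_group: "\<lbrakk>X \<in> Ob \<C>; Y \<in> Ob \<C>\<rbrakk> \<Longrightarrow> abelian_group (Hom \<C> X Y)"
    and Cmp_add_right: "\<lbrakk>X \<in> Ob \<C>; Y \<in> Ob \<C>; Z \<in> Ob \<C>;
        f \<in> mors \<C> X Y; f' \<in> mors \<C> X Y; g \<in> mors \<C> Y Z\<rbrakk>
      \<Longrightarrow> g \<cdot> (f \<oplus>\<^bsub>Hom \<C> X Y\<^esub> f') = (g \<cdot> f) \<oplus>\<^bsub>Hom \<C> X Z\<^esub> (g \<cdot> f')"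
    and Cmp_add_left: "\<lbrakk>X \<in> Ob \<C>; Y \<in> Ob \<C>; Z \<in> Ob \<C>;
        f \<in> mors \<C> X Y; g \<in> mors \<C> Y Z; g' \<in> mors \<C> Y Z\<rbrakk>
      \<Longrightarrow> (g \<oplus>\<^bsub>Hom \<C> Y Z\<^esub> g') \<cdot> f = (g \<cdot> f) \<oplus>\<^bsub>Hom \<C> X Z\<^esub> (g' \<cdot> f)"
    and zero_object_exists: "\<exists>Z. zero_object \<C> Z"
    and biproducts: "\<lbrakk>X \<in> Ob \<C>; Y \<in> Ob \<C>\<rbrakk> \<Longrightarrow>
        X \<boxplus> Y \<in> Ob \<C>
      \<and> in1 \<C> X Y \<in> mors \<C> X (X \<boxplus> Y) \<and> in2 \<C> X Y \<in> mors \<C> Y (X \<boxplus> Y)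
      \<and> pr1 \<C> X Y \<in> mors \<C> (X \<boxplus> Y) X \<and> pr2 \<C> X Y \<in> mors \<C> (X \<boxplus> Y) Y
      \<and> pr1 \<C> X Y \<cdot> in1 \<C> X Y = Idm \<C> X \<and> pr2 \<C> X Y \<cdot> in2 \<C> X Y = Idm \<C> Y
      \<and> pr2 \<C> X Y \<cdot> in1 \<C> X Y = \<zero>\<^bsub>Hom \<C> X Y\<^esub> \<and> pr1 \<C> X Y \<cdot> in2 \<C> X Y = \<zero>\<^bsub>Hom \<C> Y X\<^esub>
      \<and> (in1 \<C> X Y \<cdot> pr1 \<C> X Y) \<oplus>\<^bsub>Hom \<C> (X \<boxplus> Y) (X \<boxplus> Y)\<^esub> (in2 \<C> X Y \<cdot> pr2 \<C> X Y)
          = Idm \<C> (X \<boxplus> Y)"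

text \<open>
  For \<open>f : X \<rightarrow> Y\<close> and \<open>f' : X \<rightarrow> Y'\<close>, the morphism \<open>X \<rightarrow> Y \<boxplus> Y'\<close> given by the column \<open>(f, f')\<close>.
\<close>

definition col_mor :: "('o, 'm, 'x) add_cat_scheme \<Rightarrow> 'o \<Rightarrow> 'o \<Rightarrow> 'o \<Rightarrow> 'm \<Rightarrow> 'm \<Rightarrow> 'm"
  where "col_mor \<C> X Y Y' f f' =
    (in1 \<C> Y Y' \<cdot>\<^bsub>\<C>\<^esub> f) \<oplus>\<^bsub>Hom \<C> X (Y \<boxplus>\<^bsub>\<C>\<^esub> Y')\<^esub> (in2 \<C> Y Y' \<cdot>\<^bsub>\<C>\<^esub> f')"

text \<open>
  For \<open>g : Y \<rightarrow> Z\<close> and \<open>g' : Y' \<rightarrow> Z\<close>, the morphism \<open>Y \<boxplus> Y' \<rightarrow> Z\<close> given by the row \<open>(g, g')\<close>.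
\<close>

definition row_mor :: "('o, 'm, 'x) add_cat_scheme \<Rightarrow> 'o \<Rightarrow> 'o \<Rightarrow> 'o \<Rightarrow> 'm \<Rightarrow> 'm \<Rightarrow> 'm"
  where "row_mor \<C> Y Y' Z g g' =
    (g \<cdot>\<^bsub>\<C>\<^esub> pr1 \<C> Y Y') \<oplus>\<^bsub>Hom \<C> (Y \<boxplus>\<^bsub>\<C>\<^esub> Y') Z\<^esub> (g' \<cdot>\<^bsub>\<C>\<^esub> pr2 \<C> Y Y')"

text \<open>The direct sum of \<open>f : X \<rightarrow> Y\<close> and \<open>f' : X' \<rightarrow> Y'\<close>.\<close>

definition dsum_mor :: "('o, 'm, 'x) add_cat_scheme \<Rightarrow> 'o \<Rightarrow> 'o \<Rightarrow> 'o \<Rightarrow> 'o \<Rightarrow> 'm \<Rightarrow> 'm \<Rightarrow> 'm"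
  where "dsum_mor \<C> X X' Y Y' f f' =
    col_mor \<C> (X \<boxplus>\<^bsub>\<C>\<^esub> X') Y Y' (f \<cdot>\<^bsub>\<C>\<^esub> pr1 \<C> X X') (f' \<cdot>\<^bsub>\<C>\<^esub> pr2 \<C> X X')"


section \<open>Additive bifunctors and realizations\<close>

text \<open>
  \<open>Ext \<C> Z X\<close> is the group of extensions \<open>\<bbbE>(Z, X)\<close>, contravariant in \<open>Z\<close>; \<open>push \<C> f \<delta>\<close> is
  \<open>f\<^sub>*\<delta>\<close> and \<open>pull \<C> g \<delta>\<close> is \<open>g\<^sup>*\<delta>\<close>. For \<open>\<delta> \<in> \<bbbE>(Z, X)\<close>, \<open>realize \<C> Z X \<delta>\<close> is the equivalence class
  of the sequences \<open>X \<rightarrow> Y \<rightarrow> Z\<close> (encoded as \<open>(Y, f, g)\<close>) realizing \<open>\<delta>\<close>.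
\<close>

record ('o, 'm, 'e) ext_cat = "('o, 'm) add_cat" +
  Ext :: "'o \<Rightarrow> 'o \<Rightarrow> 'e ring"
  push :: "'m \<Rightarrow> 'e \<Rightarrow> 'e"
  pull :: "'m \<Rightarrow> 'e \<Rightarrow> 'e"
  realize :: "'o \<Rightarrow> 'o \<Rightarrow> 'e \<Rightarrow> ('o \<times> 'm \<times> 'm) set"

abbreviation exts :: "('o, 'm, 'e, 'x) ext_cat_scheme \<Rightarrow> 'o \<Rightarrow> 'o \<Rightarrow> 'e set"
  where "exts \<C> Z X \<equiv> carrier (Ext \<C> Z X)"

locale additive_bifunctor = additive_category \<C>
  for \<C> :: "('o, 'm, 'e, 'x) ext_cat_scheme" (structure) +
  assumes Ext_abelian_group: "\<lbrakk>Z \<in> Ob \<C>; X \<in> Ob \<C>\<rbrakk> \<Longrightarrow> abelian_group (Ext \<C> Z X)"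
    and push_closed: "\<lbrakk>Z \<in> Ob \<C>; X \<in> Ob \<C>; X' \<in> Ob \<C>; f \<in> mors \<C> X X'; \<delta> \<in> exts \<C> Z X\<rbrakk>
      \<Longrightarrow> push \<C> f \<delta> \<in> exts \<C> Z X'"
    and pull_closed: "\<lbrakk>Z \<in> Ob \<C>; Z' \<in> Ob \<C>; X \<in> Ob \<C>; g \<in> mors \<C> Z' Z; \<delta> \<in> exts \<C> Z X\<rbrakk>
      \<Longrightarrow> pull \<C> g \<delta> \<in> exts \<C> Z' X"
    and push_add: "\<lbrakk>Z \<in> Ob \<C>; X \<in> Ob \<C>; X' \<in> Ob \<C>; f \<in> mors \<C> X X';
        \<delta> \<in> exts \<C> Z X; \<delta>' \<in> exts \<C> Z X\<rbrakk>
      \<Longrightarrow> push \<C> f (\<delta> \<oplus>\<^bsub>Ext \<C> Z X\<^esub> \<delta>') = push \<C> f \<delta> \<oplus>\<^bsub>Ext \<C> Z X'\<^esub> push \<C> f \<delta>'"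
    and pull_add: "\<lbrakk>Z \<in> Ob \<C>; Z' \<in> Ob \<C>; X \<in> Ob \<C>; g \<in> mors \<C> Z' Z;
        \<delta> \<in> exts \<C> Z X; \<delta>' \<in> exts \<C> Z X\<rbrakk>
      \<Longrightarrow> pull \<C> g (\<delta> \<oplus>\<^bsub>Ext \<C> Z X\<^esub> \<delta>') = pull \<C> g \<delta> \<oplus>\<^bsub>Ext \<C> Z' X\<^esub> pull \<C> g \<delta>'"
    and push_Idm: "\<lbrakk>Z \<in> Ob \<C>; X \<in> Ob \<C>; \<delta> \<in> exts \<C> Z X\<rbrakk> \<Longrightarrow> push \<C> (Idm \<C> X) \<delta> = \<delta>"
    and pull_Idm: "\<lbrakk>Z \<in> Ob \<C>; X \<in> Ob \<C>; \<delta> \<in> exts \<C> Z X\<rbrakk> \<Longrightarrow> pull \<C> (Idm \<C> Z) \<delta> = \<delta>"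
    and push_Cmp: "\<lbrakk>Z \<in> Ob \<C>; X \<in> Ob \<C>; X' \<in> Ob \<C>; X'' \<in> Ob \<C>;
        f \<in> mors \<C> X X'; f' \<in> mors \<C> X' X''; \<delta> \<in> exts \<C> Z X\<rbrakk>
      \<Longrightarrow> push \<C> (f' \<cdot> f) \<delta> = push \<C> f' (push \<C> f \<delta>)"
    and pull_Cmp: "\<lbrakk>Z \<in> Ob \<C>; Z' \<in> Ob \<C>; Z'' \<in> Ob \<C>; X \<in> Ob \<C>;
        g \<in> mors \<C> Z' Z; g' \<in> mors \<C> Z'' Z'; \<delta> \<in> exts \<C> Z X\<rbrakk>
      \<Longrightarrow> pull \<C> (g \<cdot> g') \<delta> = pull \<C> g' (pull \<C> g \<delta>)"
    and push_pull: "\<lbrakk>Z \<in> Ob \<C>; Z' \<in> Ob \<C>; X \<in> Ob \<C>; X' \<in> Ob \<C>;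
        f \<in> mors \<C> X X'; g \<in> mors \<C> Z' Z; \<delta> \<in> exts \<C> Z X\<rbrakk>
      \<Longrightarrow> push \<C> f (pull \<C> g \<delta>) = pull \<C> g (push \<C> f \<delta>)"
    and push_add_mor: "\<lbrakk>Z \<in> Ob \<C>; X \<in> Ob \<C>; X' \<in> Ob \<C>;
        f \<in> mors \<C> X X'; f' \<in> mors \<C> X X'; \<delta> \<in> exts \<C> Z X\<rbrakk>
      \<Longrightarrow> push \<C> (f \<oplus>\<^bsub>Hom \<C> X X'\<^esub> f') \<delta> = push \<C> f \<delta> \<oplus>\<^bsub>Ext \<C> Z X'\<^esub> push \<C> f' \<delta>"
    and pull_add_mor: "\<lbrakk>Z \<in> Ob \<C>; Z' \<in> Ob \<C>; X \<in> Ob \<C>;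
        g \<in> mors \<C> Z' Z; g' \<in> mors \<C> Z' Z; \<delta> \<in> exts \<C> Z X\<rbrakk>
      \<Longrightarrow> pull \<C> (g \<oplus>\<^bsub>Hom \<C> Z' Z\<^esub> g') \<delta> = pull \<C> g \<delta> \<oplus>\<^bsub>Ext \<C> Z' X\<^esub> pull \<C> g' \<delta>"

text \<open>
  For \<open>\<delta> \<in> \<bbbE>(Z, X)\<close> and \<open>\<delta>' \<in> \<bbbE>(Z', X')\<close>, the extension \<open>\<delta> \<oplus> \<delta>' \<in> \<bbbE>(Z \<boxplus> Z', X \<boxplus> X')\<close> corresponding
  to \<open>(\<delta>, 0, 0, \<delta>')\<close> under the additivity isomorphism.
\<close>

definition dsum_ext :: "('o, 'm, 'e, 'x) ext_cat_scheme \<Rightarrow> 'o \<Rightarrow> 'o \<Rightarrow> 'o \<Rightarrow> 'o \<Rightarrow> 'e \<Rightarrow> 'e \<Rightarrow> 'e"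
  where "dsum_ext \<C> Z Z' X X' \<delta> \<delta>' =
    push \<C> (in1 \<C> X X') (pull \<C> (pr1 \<C> Z Z') \<delta>)
      \<oplus>\<^bsub>Ext \<C> (Z \<boxplus>\<^bsub>\<C>\<^esub> Z') (X \<boxplus>\<^bsub>\<C>\<^esub> X')\<^esub>
    push \<C> (in2 \<C> X X') (pull \<C> (pr2 \<C> Z Z') \<delta>')"

definition seqs :: "('o, 'm, 'x) add_cat_scheme \<Rightarrow> 'o \<Rightarrow> 'o \<Rightarrow> ('o \<times> 'm \<times> 'm) set"
  where "seqs \<C> X Z = {(Y, f, g). Y \<in> Ob \<C> \<and> f \<in> mors \<C> X Y \<and> g \<in> mors \<C> Y Z}"

definition seq_equiv :: "('o, 'm, 'x) add_cat_scheme \<Rightarrow> 'o \<Rightarrow> 'o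
    \<Rightarrow> (('o \<times> 'm \<times> 'm) \<times> ('o \<times> 'm \<times> 'm)) set"
  where "seq_equiv \<C> X Z = {((Y, f, g), (Y', f', g')).
    (Y, f, g) \<in> seqs \<C> X Z \<and> (Y', f', g') \<in> seqs \<C> X Z \<and>
    (\<exists>h. iso_mor \<C> Y Y' h \<and> h \<cdot>\<^bsub>\<C>\<^esub> f = f' \<and> g' \<cdot>\<^bsub>\<C>\<^esub> h = g)}"

locale additive_realization = additive_bifunctor \<C>
  for \<C> :: "('o, 'm, 'e, 'x) ext_cat_scheme" (structure) +
  assumes realize_class: "\<lbrakk>Z \<in> Ob \<C>; X \<in> Ob \<C>; \<delta> \<in> exts \<C> Z X\<rbrakk>
      \<Longrightarrow> realize \<C> Z X \<delta> \<in> seqs \<C> X Z // seq_equiv \<C> X Z"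
    and realize_mor: "\<lbrakk>Z \<in> Ob \<C>; X \<in> Ob \<C>; Z' \<in> Ob \<C>; X' \<in> Ob \<C>;
        \<delta> \<in> exts \<C> Z X; \<delta>' \<in> exts \<C> Z' X'; \<alpha> \<in> mors \<C> X X'; \<gamma> \<in> mors \<C> Z Z';
        push \<C> \<alpha> \<delta> = pull \<C> \<gamma> \<delta>'; (Y, f, g) \<in> realize \<C> Z X \<delta>; (Y', f', g') \<in> realize \<C> Z' X' \<delta>'\<rbrakk>
      \<Longrightarrow> \<exists>\<beta> \<in> mors \<C> Y Y'. \<beta> \<cdot> f = f' \<cdot> \<alpha> \<and> g' \<cdot> \<beta> = \<gamma> \<cdot> g"
    and realize_zero: "\<lbrakk>Z \<in> Ob \<C>; X \<in> Ob \<C>\<rbrakk>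
      \<Longrightarrow> (X \<boxplus> Z, in1 \<C> X Z, pr2 \<C> X Z) \<in> realize \<C> Z X \<zero>\<^bsub>Ext \<C> Z X\<^esub>"
    and realize_dsum: "\<lbrakk>Z \<in> Ob \<C>; X \<in> Ob \<C>; Z' \<in> Ob \<C>; X' \<in> Ob \<C>;
        \<delta> \<in> exts \<C> Z X; \<delta>' \<in> exts \<C> Z' X';
        (Y, f, g) \<in> realize \<C> Z X \<delta>; (Y', f', g') \<in> realize \<C> Z' X' \<delta>'\<rbrakk>
      \<Longrightarrow> (Y \<boxplus> Y', dsum_mor \<C> X X' Y Y' f f', dsum_mor \<C> Y Y' Z Z' g g')
        \<in> realize \<C> (Z \<boxplus> Z') (X \<boxplus> X') (dsum_ext \<C> Z Z' X X' \<delta> \<delta>')"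


section \<open>Extriangulated categories\<close>

text \<open>\<open>Tri X f Y g Z \<delta>\<close> stands for \<open>X \<rightarrow> Y \<rightarrow> Z\<close> with maps \<open>f\<close>, \<open>g\<close> and extension \<open>\<delta>\<close>.\<close>

datatype ('o, 'm, 'e) tri =
  Tri (ob1: 'o) (mor1: 'm) (ob2: 'o) (mor2: 'm) (ob3: 'o) (ext: 'e)

definition is_etri :: "('o, 'm, 'e, 'x) ext_cat_scheme \<Rightarrow> ('o, 'm, 'e) tri \<Rightarrow> bool"
  where "is_etri \<C> T \<longleftrightarrow> ob1 T \<in> Ob \<C> \<and> ob3 T \<in> Ob \<C> \<and> ext T \<in> exts \<C> (ob3 T) (ob1 T) \<and>
    (ob2 T, mor1 T, mor2 T) \<in> realize \<C> (ob3 T) (ob1 T) (ext T)"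

definition inflation :: "('o, 'm, 'e, 'x) ext_cat_scheme \<Rightarrow> 'o \<Rightarrow> 'o \<Rightarrow> 'm \<Rightarrow> bool"
  where "inflation \<C> X Y f \<longleftrightarrow> (\<exists>g Z \<delta>. is_etri \<C> (Tri X f Y g Z \<delta>))"

definition etri_mor :: "('o, 'm, 'e, 'x) ext_cat_scheme \<Rightarrow> ('o, 'm, 'e) tri \<Rightarrow> ('o, 'm, 'e) tri
    \<Rightarrow> 'm \<Rightarrow> 'm \<Rightarrow> 'm \<Rightarrow> bool"
  where "etri_mor \<C> T T' \<alpha> \<beta> \<gamma> \<longleftrightarrow> is_etri \<C> T \<and> is_etri \<C> T' \<and>
    \<alpha> \<in> mors \<C> (ob1 T) (ob1 T') \<and> \<beta> \<in> mors \<C> (ob2 T) (ob2 T') \<and> \<gamma> \<in> mors \<C> (ob3 T) (ob3 T') \<and>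
    \<beta> \<cdot>\<^bsub>\<C>\<^esub> mor1 T = mor1 T' \<cdot>\<^bsub>\<C>\<^esub> \<alpha> \<and> mor2 T' \<cdot>\<^bsub>\<C>\<^esub> \<beta> = \<gamma> \<cdot>\<^bsub>\<C>\<^esub> mor2 T \<and>
    push \<C> \<alpha> (ext T) = pull \<C> \<gamma> (ext T')"

locale extriangulated_category = additive_realization \<C>
  for \<C> :: "('o, 'm, 'e, 'x) ext_cat_scheme" (structure) +
  assumes ET3: "\<lbrakk>is_etri \<C> T; is_etri \<C> T'; \<alpha> \<in> mors \<C> (ob1 T) (ob1 T');
        \<beta> \<in> mors \<C> (ob2 T) (ob2 T'); \<beta> \<cdot> mor1 T = mor1 T' \<cdot> \<alpha>\<rbrakk>
      \<Longrightarrow> \<exists>\<gamma>. etri_mor \<C> T T' \<alpha> \<beta> \<gamma>"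
    and ET3_op: "\<lbrakk>is_etri \<C> T; is_etri \<C> T'; \<beta> \<in> mors \<C> (ob2 T) (ob2 T');
        \<gamma> \<in> mors \<C> (ob3 T) (ob3 T'); \<gamma> \<cdot> mor2 T = mor2 T' \<cdot> \<beta>\<rbrakk>
      \<Longrightarrow> \<exists>\<alpha>. etri_mor \<C> T T' \<alpha> \<beta> \<gamma>"
    and ET4: "\<lbrakk>is_etri \<C> (Tri A f B g D \<delta>); is_etri \<C> (Tri B u C v E \<epsilon>)\<rbrakk>
      \<Longrightarrow> \<exists>m h F \<theta> w q \<eta>. is_etri \<C> (Tri A m C h F \<theta>) \<and> is_etri \<C> (Tri D w F q E \<eta>) \<and>
        m = u \<cdot> f \<and> w \<cdot> g = h \<cdot> u \<and> v = q \<cdot> h \<and>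
        pull \<C> w \<theta> = \<delta> \<and> push \<C> g \<epsilon> = \<eta> \<and> push \<C> f \<theta> = pull \<C> q \<epsilon>"
    and ET4_op: "\<lbrakk>is_etri \<C> (Tri A m C h F \<theta>); is_etri \<C> (Tri D w F q E \<eta>)\<rbrakk>
      \<Longrightarrow> \<exists>f B g \<delta> u v \<epsilon>. is_etri \<C> (Tri A f B g D \<delta>) \<and> is_etri \<C> (Tri B u C v E \<epsilon>) \<and>
        m = u \<cdot> f \<and> w \<cdot> g = h \<cdot> u \<and> v = q \<cdot> h \<and>
        pull \<C> w \<theta> = \<delta> \<and> push \<C> g \<epsilon> = \<eta> \<and> push \<C> f \<theta> = pull \<C> q \<epsilon>"

definition homotopic_mor :: "('o, 'm, 'e, 'x) ext_cat_scheme \<Rightarrow> ('o, 'm, 'e) tri \<Rightarrow> ('o, 'm, 'e) tri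
    \<Rightarrow> 'm \<Rightarrow> 'm \<Rightarrow> 'm \<Rightarrow> bool"
  where "homotopic_mor \<C> T T' \<alpha> \<beta> \<gamma> \<longleftrightarrow> etri_mor \<C> T T' \<alpha> \<beta> \<gamma> \<and>
    (\<exists>s E t \<eta> \<beta>1 \<beta>2.
      is_etri \<C> (Tri (ob1 T') s E t (ob3 T) \<eta>) \<and>
      \<beta>1 \<in> mors \<C> (ob2 T) E \<and> \<beta>2 \<in> mors \<C> E (ob2 T') \<and> \<beta> = \<beta>2 \<cdot>\<^bsub>\<C>\<^esub> \<beta>1 \<and>
      etri_mor \<C> T (Tri (ob1 T') s E t (ob3 T) \<eta>) \<alpha> \<beta>1 (Idm \<C> (ob3 T)) \<and>
      etri_mor \<C> (Tri (ob1 T') s E t (ob3 T) \<eta>) T' (Idm \<C> (ob1 T')) \<beta>2 \<gamma> \<and>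
      is_etri \<C> (Tri
        (ob1 T) (col_mor \<C> (ob1 T) (ob2 T) (ob1 T') (mor1 T) \<alpha>)
        (ob2 T \<boxplus>\<^bsub>\<C>\<^esub> ob1 T') (row_mor \<C> (ob2 T) (ob1 T') E \<beta>1 (\<ominus>\<^bsub>Hom \<C> (ob1 T') E\<^esub> s))
        E (pull \<C> t (ext T))) \<and>
      is_etri \<C> (Tri
        E (col_mor \<C> E (ob3 T) (ob2 T') (\<ominus>\<^bsub>Hom \<C> E (ob3 T)\<^esub> t) \<beta>2)
        (ob3 T \<boxplus>\<^bsub>\<C>\<^esub> ob2 T') (row_mor \<C> (ob3 T) (ob2 T') (ob3 T') \<gamma> (mor2 T'))
        (ob3 T') (push \<C> s (ext T'))))"

text \<open>\<open>RA\<close>, \<open>RB\<close>, \<open>RC\<close> are the rows and \<open>K1\<close>, \<open>K2\<close>, \<open>K3\<close> the columns.\<close>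

definition diagram_3x3 :: "('o, 'm, 'e, 'x) ext_cat_scheme
    \<Rightarrow> ('o, 'm, 'e) tri \<Rightarrow> ('o, 'm, 'e) tri \<Rightarrow> ('o, 'm, 'e) tri
    \<Rightarrow> ('o, 'm, 'e) tri \<Rightarrow> ('o, 'm, 'e) tri \<Rightarrow> ('o, 'm, 'e) tri \<Rightarrow> bool"
  where "diagram_3x3 \<C> RA RB RC K1 K2 K3 \<longleftrightarrow>
    is_etri \<C> RA \<and> is_etri \<C> RB \<and> is_etri \<C> RC \<and> is_etri \<C> K1 \<and> is_etri \<C> K2 \<and> is_etri \<C> K3 \<and>
    ob1 K1 = ob1 RA \<and> ob2 K1 = ob1 RB \<and> ob3 K1 = ob1 RC \<and>
    ob1 K2 = ob2 RA \<and> ob2 K2 = ob2 RB \<and> ob3 K2 = ob2 RC \<and>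
    ob1 K3 = ob3 RA \<and> ob2 K3 = ob3 RB \<and> ob3 K3 = ob3 RC \<and>
    etri_mor \<C> RA RB (mor1 K1) (mor1 K2) (mor1 K3) \<and>
    etri_mor \<C> RB RC (mor2 K1) (mor2 K2) (mor2 K3) \<and>
    etri_mor \<C> K1 K2 (mor1 RA) (mor1 RB) (mor1 RC) \<and>
    etri_mor \<C> K2 K3 (mor2 RA) (mor2 RB) (mor2 RC)"

end

theory Submission
  imports Defs
begin

text \<open>
  The proof treats an extension \<open>\<delta> \<in> \<bbbE>(Z, X)\<close> as an arrow \<open>Z \<rightarrow> X\<close> of degree one, next to the
  morphisms, which have degree zero. Then \<open>f\<^sub>*\<delta>\<close> and \<open>g\<^sup>*\<delta>\<close> are the composites \<open>f \<bullet> \<delta>\<close> and \<open>\<delta> \<bullet> g\<close>, and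
  functoriality, the bifunctor law and biadditivity all become associativity and
  distributivity of one partial composition. In this form the axioms of an extriangulated
  category are self-dual, so that each result about pushouts, inflations or cones yields its dual
  by reversing all arrows (\<open>extri_arrows_op\<close>).

  Let \<open>i\<^sub>1, i\<^sub>3\<close> be the given inflations, with cones \<open>p\<^sub>1, p\<^sub>3\<close>. Realize the common extension
  \<open>(i\<^sub>1)\<^sub>*\<delta>\<^sub>A = (i\<^sub>3)\<^sup>*\<delta>\<^sub>B\<close> by \<open>B\<^sub>1 \<rightarrow> E \<rightarrow> A\<^sub>3\<close> with maps \<open>s\<close> and \<open>t\<close>. The morphism of triangles is built as
  \<open>A\<^sub>2 \<rightarrow> E \<rightarrow> B\<^sub>2\<close> with maps \<open>b\<^sub>1\<close> and \<open>b\<^sub>2\<close>, which are chosen independently of each other: \<open>b\<^sub>1\<close> makes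
  the square on \<open>A\<^sub>1, A\<^sub>2, B\<^sub>1, E\<close> a homotopy pushout (\<open>pushout_square\<close>, from (ET4)), and \<open>b\<^sub>2\<close> makes
  the square on \<open>E, A\<^sub>3, B\<^sub>2, B\<^sub>3\<close> a homotopy pullback (\<open>pullback_square\<close>, its dual). So \<open>b\<^sub>2 b\<^sub>1\<close> is
  homotopic by construction.

  Parallel sides of these squares have the same cone. For \<open>b\<^sub>1\<close> (\<open>inflation_of_pushout\<close>),
  the pushout of \<open>i\<^sub>1\<close> along \<open>f\<^sub>A\<close> and the pushout of \<open>f\<^sub>A\<close> along \<open>i\<^sub>1\<close> are both cones of the inflation
  \<open>A\<^sub>1 \<rightarrow> A\<^sub>2 \<oplus> B\<^sub>1\<close>, hence isomorphic, and the first gives a triangle \<open>A\<^sub>2 \<rightarrow> E \<rightarrow> C\<^sub>1\<close>. For \<open>b\<^sub>2\<close>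
  (\<open>inflation_of_pullback\<close>), (ET4) is applied to \<open>E \<rightarrow> A\<^sub>3 \<oplus> B\<^sub>2 \<rightarrow> B\<^sub>3 \<oplus> B\<^sub>2\<close>, where the second map is
  chosen so that the composite is zero on the summand \<open>B\<^sub>3\<close>; the cone of the composite
  splits as \<open>B\<^sub>3 \<oplus> C\<^sub>3\<close>, and (ET4)\<open>\<^sup>o\<^sup>p\<close> removes the summand \<open>B\<^sub>3\<close>, leaving \<open>E \<rightarrow> B\<^sub>2 \<rightarrow> C\<^sub>3\<close>.

  Finally (ET4) for the two inflations \<open>b\<^sub>1, b\<^sub>2\<close> gives the cone of \<open>b\<^sub>2 b\<^sub>1\<close> together with the third row,
  and the compatibilities of (ET4) and of the two squares are exactly those of a 3 x 3 diagram
  (\<open>homotopic_grid\<close>). When \<open>i\<^sub>1\<close> factors through \<open>f\<^sub>A\<close> and \<open>\<delta>\<^sub>B = 0\<close>, both extensions to be compared vanish, so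
  the first part applies; the second row is isomorphic to the split one, and the whole
  diagram is transported along this isomorphism.
\<close>

section \<open>Graded preadditive arrow systems\<close>

text \<open>
  Arrows of degree at most one between objects: \<open>dg\<close> is the degree, and a composite is meaningful
  only if its total degree is at most one. The axioms are invariant under exchanging \<open>dm\<close> with \<open>cd\<close> and
  the injections \<open>i1, i2\<close> with the projections \<open>p2, p1\<close>. The laws of domain, codomain and degree are
  unconditional where possible, so that rewriting computes the type of a composite by itself.
\<close>

locale graded_arrows =
  fixes Obj :: "'o set"
    and ok :: "'a \<Rightarrow> bool" and dm :: "'a \<Rightarrow> 'o" and cd :: "'a \<Rightarrow> 'o" and dg :: "'a \<Rightarrow> nat"
    and cmp :: "'a \<Rightarrow> 'a \<Rightarrow> 'a"  (infixr \<open>\<bullet>\<close> 75)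
    and add :: "'a \<Rightarrow> 'a \<Rightarrow> 'a"  (infixl \<open>\<uplus>\<close> 65)
    and neg :: "'a \<Rightarrow> 'a"
    and zer :: "nat \<Rightarrow> 'o \<Rightarrow> 'o \<Rightarrow> 'a"
    and idn :: "'o \<Rightarrow> 'a"
    and bp :: "'o \<Rightarrow> 'o \<Rightarrow> 'o"
    and i1 i2 p1 p2 :: "'o \<Rightarrow> 'o \<Rightarrow> 'a"
  assumes ok_Obj: "ok a \<Longrightarrow> dm a \<in> Obj \<and> cd a \<in> Obj \<and> dg a \<le> 1"
    and ok_cmp: "\<lbrakk>ok a; ok b; dm a = cd b; dg a + dg b \<le> 1\<rbrakk> \<Longrightarrow> ok (a \<bullet> b)"
    and dm_cmp: "dm (a \<bullet> b) = dm b"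
    and cd_cmp: "cd (a \<bullet> b) = cd a"
    and dg_cmp: "dg a + dg b \<le> 1 \<Longrightarrow> dg (a \<bullet> b) = dg a + dg b"
    and cmp_assoc: "\<lbrakk>ok a; ok b; ok c; dm a = cd b; dm b = cd c; dg a + dg b + dg c \<le> 1\<rbrakk>
      \<Longrightarrow> (a \<bullet> b) \<bullet> c = a \<bullet> (b \<bullet> c)"
    and idn_typ: "X \<in> Obj \<Longrightarrow> ok (idn X)" "dm (idn X) = X" "cd (idn X) = X" "dg (idn X) = 0"
    and cmp_idn: "\<lbrakk>ok a; dm a = X\<rbrakk> \<Longrightarrow> a \<bullet> idn X = a"
    and idn_cmp: "\<lbrakk>ok a; cd a = X\<rbrakk> \<Longrightarrow> idn X \<bullet> a = a"
    and ok_add: "\<lbrakk>ok a; ok b; dm a = dm b; cd a = cd b; dg a = dg b\<rbrakk> \<Longrightarrow> ok (a \<uplus> b)"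
    and add_typ: "dm (a \<uplus> b) = dm a" "cd (a \<uplus> b) = cd a" "dg (a \<uplus> b) = dg a"
    and ok_neg: "ok a \<Longrightarrow> ok (neg a)"
    and neg_typ: "dm (neg a) = dm a" "cd (neg a) = cd a" "dg (neg a) = dg a"
    and ok_zer: "\<lbrakk>X \<in> Obj; Y \<in> Obj; n \<le> 1\<rbrakk> \<Longrightarrow> ok (zer n X Y)"
    and zer_typ: "dm (zer n X Y) = X" "cd (zer n X Y) = Y" "n \<le> 1 \<Longrightarrow> dg (zer n X Y) = n"
    and add_assoc: "\<lbrakk>ok a; ok b; ok c; dm a = dm b; cd a = cd b; dg a = dg b;
        dm b = dm c; cd b = cd c; dg b = dg c\<rbrakk> \<Longrightarrow> (a \<uplus> b) \<uplus> c = a \<uplus> (b \<uplus> c)"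
    and add_comm: "\<lbrakk>ok a; ok b; dm a = dm b; cd a = cd b; dg a = dg b\<rbrakk> \<Longrightarrow> a \<uplus> b = b \<uplus> a"
    and zer_add: "\<lbrakk>ok a; dm a = X; cd a = Y; dg a = n\<rbrakk> \<Longrightarrow> zer n X Y \<uplus> a = a"
    and add_neg: "ok a \<Longrightarrow> a \<uplus> neg a = zer (dg a) (dm a) (cd a)"
    and cmp_add: "\<lbrakk>ok a; ok b; ok c; dm b = dm c; cd b = cd c; dg b = dg c; dm a = cd b; dg a + dg b \<le> 1\<rbrakk>
      \<Longrightarrow> a \<bullet> (b \<uplus> c) = a \<bullet> b \<uplus> a \<bullet> c"
    and add_cmp: "\<lbrakk>ok a; ok b; ok c; dm b = dm c; cd b = cd c; dg b = dg c; dm b = cd a; dg a + dg b \<le> 1\<rbrakk>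
      \<Longrightarrow> (b \<uplus> c) \<bullet> a = b \<bullet> a \<uplus> c \<bullet> a"
    and zero_object: "\<exists>N \<in> Obj. idn N = zer 0 N N"
    and bp_Obj: "\<lbrakk>X \<in> Obj; Y \<in> Obj\<rbrakk> \<Longrightarrow> bp X Y \<in> Obj"
    and ok_bp: "\<lbrakk>X \<in> Obj; Y \<in> Obj\<rbrakk> \<Longrightarrow> ok (i1 X Y)" "\<lbrakk>X \<in> Obj; Y \<in> Obj\<rbrakk> \<Longrightarrow> ok (i2 X Y)"
       "\<lbrakk>X \<in> Obj; Y \<in> Obj\<rbrakk> \<Longrightarrow> ok (p1 X Y)" "\<lbrakk>X \<in> Obj; Y \<in> Obj\<rbrakk> \<Longrightarrow> ok (p2 X Y)"
    and bp_typ: "dm (i1 X Y) = X" "cd (i1 X Y) = bp X Y" "dg (i1 X Y) = 0"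
       "dm (i2 X Y) = Y" "cd (i2 X Y) = bp X Y" "dg (i2 X Y) = 0"
       "dm (p1 X Y) = bp X Y" "cd (p1 X Y) = X" "dg (p1 X Y) = 0"
       "dm (p2 X Y) = bp X Y" "cd (p2 X Y) = Y" "dg (p2 X Y) = 0"
    and p1_i1: "\<lbrakk>X \<in> Obj; Y \<in> Obj\<rbrakk> \<Longrightarrow> p1 X Y \<bullet> i1 X Y = idn X"
    and p2_i2: "\<lbrakk>X \<in> Obj; Y \<in> Obj\<rbrakk> \<Longrightarrow> p2 X Y \<bullet> i2 X Y = idn Y"
    and p2_i1: "\<lbrakk>X \<in> Obj; Y \<in> Obj\<rbrakk> \<Longrightarrow> p2 X Y \<bullet> i1 X Y = zer 0 X Y"
    and p1_i2: "\<lbrakk>X \<in> Obj; Y \<in> Obj\<rbrakk> \<Longrightarrow> p1 X Y \<bullet> i2 X Y = zer 0 Y X"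
    and bp_sum: "\<lbrakk>X \<in> Obj; Y \<in> Obj\<rbrakk> \<Longrightarrow> i1 X Y \<bullet> p1 X Y \<uplus> i2 X Y \<bullet> p2 X Y = idn (bp X Y)"
begin

text \<open>
  None of the laws is declared as a default simplification rule: the locale is interpreted in its
  own dual, where associativity would be oriented the other way and rewriting would not terminate.
\<close>

lemmas typing = ok_cmp dm_cmp cd_cmp dg_cmp idn_typ ok_add add_typ ok_neg neg_typ ok_zer zer_typ
  bp_Obj ok_bp bp_typ

lemma add_zer: "\<lbrakk>ok a; dm a = X; cd a = Y; dg a = n\<rbrakk> \<Longrightarrow> a \<uplus> zer n X Y = a"
  using zer_add[of a X Y n] add_comm[of a "zer n X Y"] ok_Obj[of a] by (simp add: typing)

lemma neg_add_cancel: "\<lbrakk>ok a; ok b; dm a = dm b; cd a = cd b; dg a = dg b\<rbrakk> \<Longrightarrow> neg a \<uplus> (a \<uplus> b) = b"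
  using add_assoc[of "neg a" a b] add_comm[of "neg a" a] by (simp add: typing add_neg zer_add)

lemma add_neg_cancel: "\<lbrakk>ok a; ok b; dm a = dm b; cd a = cd b; dg a = dg b\<rbrakk> \<Longrightarrow> a \<uplus> (neg a \<uplus> b) = b"
  using add_assoc[of a "neg a" b] by (simp add: typing add_neg zer_add)

lemma neg_add_self: "ok a \<Longrightarrow> neg a \<uplus> a = zer (dg a) (dm a) (cd a)"
  using add_comm[of "neg a" a] by (simp add: typing add_neg)

lemma eq_zerI:
  assumes "ok a" "a \<uplus> a = a"
  shows "a = zer (dg a) (dm a) (cd a)"
  using neg_add_cancel[of a a] assms by (simp add: neg_add_self)

lemma neg_unique: "\<lbrakk>ok a; ok b; dm a = dm b; cd a = cd b; dg a = dg b; a \<uplus> b = zer (dg a) (dm a) (cd a)\<rbrakk>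
    \<Longrightarrow> b = neg a"
  using neg_add_cancel[of a b] by (simp add: typing add_zer)

lemma neg_neg: "ok a \<Longrightarrow> neg (neg a) = a"
  using neg_unique[of "neg a" a] by (simp add: typing neg_add_self)

lemma neg_zer: "\<lbrakk>X \<in> Obj; Y \<in> Obj; n \<le> 1\<rbrakk> \<Longrightarrow> neg (zer n X Y) = zer n X Y"
  using neg_unique[of "zer n X Y" "zer n X Y"] by (simp add: typing add_zer)

lemma add_lcomm: "\<lbrakk>ok a; ok b; ok c; dm a = dm b; cd a = cd b; dg a = dg b;
        dm b = dm c; cd b = cd c; dg b = dg c\<rbrakk> \<Longrightarrow> a \<uplus> (b \<uplus> c) = b \<uplus> (a \<uplus> c)"
  using add_assoc[of a b c] add_assoc[of b a c] add_comm[of a b] by metis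

lemma neg_add:
  assumes "ok a" "ok b" "dm a = dm b" "cd a = cd b" "dg a = dg b"
  shows "neg (a \<uplus> b) = neg a \<uplus> neg b"
proof -
  have "(a \<uplus> b) \<uplus> (neg a \<uplus> neg b) = a \<uplus> (b \<uplus> (neg a \<uplus> neg b))"
    using assms by (intro add_assoc) (simp_all add: typing)
  also have "b \<uplus> (neg a \<uplus> neg b) = neg a \<uplus> (b \<uplus> neg b)"
    using assms by (intro add_lcomm) (simp_all add: typing)
  also have "a \<uplus> \<dots> = zer (dg a) (dm a) (cd a)"
    using assms by (simp add: typing add_neg add_zer)
  finally show ?thesis
    using assms by (intro neg_unique[symmetric]) (simp_all add: typing)
qed

lemma sub_eq_zer:
  assumes "a \<uplus> neg b = zer n X Y" "ok a" "ok b" "dm a = dm b" "cd a = cd b" "dg a = dg b"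
    "dm a = X" "cd a = Y" "dg a = n"
  shows "a = b"
proof -
  have "neg b = neg a" using assms by (intro neg_unique) (simp_all add: typing)
  then show ?thesis using neg_neg[of a] neg_neg[of b] assms by metis
qed

lemma cmp_zer: "\<lbrakk>ok a; dm a = Y; X \<in> Obj; dg a + n \<le> 1\<rbrakk> \<Longrightarrow> a \<bullet> zer n X Y = zer (dg a + n) X (cd a)"
  using eq_zerI[of "a \<bullet> zer n X Y"] cmp_add[of a "zer n X Y" "zer n X Y"] ok_Obj[of a]
  by (simp add: typing add_zer)

lemma zer_cmp: "\<lbrakk>ok a; cd a = X; Y \<in> Obj; dg a + n \<le> 1\<rbrakk> \<Longrightarrow> zer n X Y \<bullet> a = zer (n + dg a) (dm a) Y"
  using eq_zerI[of "zer n X Y \<bullet> a"] add_cmp[of a "zer n X Y" "zer n X Y"] ok_Obj[of a]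
  by (simp add: typing add_zer add.commute)

lemma cmp_neg: "\<lbrakk>ok a; ok b; dm a = cd b; dg a + dg b \<le> 1\<rbrakk> \<Longrightarrow> a \<bullet> neg b = neg (a \<bullet> b)"
  using neg_unique[of "a \<bullet> b" "a \<bullet> neg b"] cmp_add[of a b "neg b"] ok_Obj[of b]
  by (simp add: typing add_neg cmp_zer)

lemma neg_cmp: "\<lbrakk>ok a; ok b; dm a = cd b; dg a + dg b \<le> 1\<rbrakk> \<Longrightarrow> neg a \<bullet> b = neg (a \<bullet> b)"
  using neg_unique[of "a \<bullet> b" "neg a \<bullet> b"] add_cmp[of b a "neg a"] ok_Obj[of a]
  by (simp add: typing add_neg zer_cmp add.commute)

text \<open>
  Composites are normalized with parentheses to the right, so an equation \<open>a \<bullet> b = c\<close> has to be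
  extended by an arbitrary tail before it applies inside a longer composite; \<open>reassoc3\<close> does the same
  for three factors.
\<close>

lemma reassoc: "\<lbrakk>a \<bullet> b = c; ok a; ok b; ok x; dm a = cd b; dm b = cd x; dg a + dg b + dg x \<le> 1\<rbrakk>
    \<Longrightarrow> a \<bullet> (b \<bullet> x) = c \<bullet> x"
  using cmp_assoc[of a b x] by simp

lemma reassoc3: "\<lbrakk>a \<bullet> (b \<bullet> c) = d; ok a; ok b; ok c; ok x; dm a = cd b; dm b = cd c; dm c = cd x;
    dg a + dg b + dg c + dg x \<le> 1\<rbrakk> \<Longrightarrow> a \<bullet> (b \<bullet> (c \<bullet> x)) = d \<bullet> x"
  using reassoc[of a "b \<bullet> c" d x] by (simp add: typing cmp_assoc)

lemma bp_reassoc: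
  assumes "X \<in> Obj" "Y \<in> Obj" "ok a"
  shows "cd a = X \<Longrightarrow> p1 X Y \<bullet> (i1 X Y \<bullet> a) = a"
    and "cd a = Y \<Longrightarrow> p2 X Y \<bullet> (i2 X Y \<bullet> a) = a"
    and "cd a = X \<Longrightarrow> p2 X Y \<bullet> (i1 X Y \<bullet> a) = zer (dg a) (dm a) Y"
    and "cd a = Y \<Longrightarrow> p1 X Y \<bullet> (i2 X Y \<bullet> a) = zer (dg a) (dm a) X"
  using assms ok_Obj[of a]
  by (simp_all add: typing reassoc[OF p1_i1] reassoc[OF p2_i2] reassoc[OF p2_i1] reassoc[OF p1_i2]
      idn_cmp zer_cmp)

text \<open>
  \<open>cat\<close> brings an expression into the form of a sum of right-nested composites; \<open>add_laws\<close> adds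
  commutativity and cancellation of opposite summands.
\<close>

lemmas cat = typing cmp_assoc cmp_idn idn_cmp cmp_add add_cmp add_assoc zer_add add_zer
  neg_neg neg_zer neg_add cmp_neg neg_cmp cmp_zer zer_cmp
  p1_i1 p2_i2 p2_i1 p1_i2 bp_reassoc

lemmas add_laws = add_neg neg_add_self neg_add_cancel add_neg_cancel add_comm add_lcomm

abbreviation arr :: "'a \<Rightarrow> 'o \<Rightarrow> 'o \<Rightarrow> bool"
  where "arr a X Y \<equiv> ok a \<and> dg a = 0 \<and> dm a = X \<and> cd a = Y \<and> X \<in> Obj \<and> Y \<in> Obj"

abbreviation extn :: "'a \<Rightarrow> 'o \<Rightarrow> 'o \<Rightarrow> bool"
  where "extn a X Y \<equiv> ok a \<and> dg a = 1 \<and> dm a = X \<and> cd a = Y \<and> X \<in> Obj \<and> Y \<in> Obj"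

abbreviation inverse_arrows :: "'a \<Rightarrow> 'a \<Rightarrow> 'o \<Rightarrow> 'o \<Rightarrow> bool"
  where "inverse_arrows a a' X Y \<equiv> arr a X Y \<and> arr a' Y X \<and> a' \<bullet> a = idn X \<and> a \<bullet> a' = idn Y"

text \<open>
  A map out of a biproduct is a row of two maps, so matrix identities are checked entrywise.
\<close>

lemma biproduct_eqI:
  assumes "X \<in> Obj" "Y \<in> Obj" "ok a" "ok b" "cd a = cd b" "dm a = bp X Y" "dm b = bp X Y" "dg a = dg b"
    and "a \<bullet> i1 X Y = b \<bullet> i1 X Y" "a \<bullet> i2 X Y = b \<bullet> i2 X Y"
  shows "a = b"
proof -
  have *: "x = (x \<bullet> i1 X Y) \<bullet> p1 X Y \<uplus> (x \<bullet> i2 X Y) \<bullet> p2 X Y" if "ok x" "dm x = bp X Y" for x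
  proof -
    have "x = x \<bullet> (i1 X Y \<bullet> p1 X Y \<uplus> i2 X Y \<bullet> p2 X Y)"
      using that assms(1,2) by (simp add: bp_sum cmp_idn)
    also have "\<dots> = (x \<bullet> i1 X Y) \<bullet> p1 X Y \<uplus> (x \<bullet> i2 X Y) \<bullet> p2 X Y"
      using that assms(1,2) ok_Obj[of x] by (simp add: typing cmp_add cmp_assoc)
    finally show ?thesis .
  qed
  show ?thesis using *[of a] *[of b] assms by metis
qed

lemma arrow_into_zero_object:
  assumes "N \<in> Obj" "idn N = zer 0 N N" "ok a" and "cd a = N"
  shows "a = zer (dg a) (dm a) N"
  using idn_cmp[of a N] zer_cmp[of a N N 0] assms ok_Obj[of a] by simp

text \<open>
  The biproduct is taken with exchanged arguments, which sends the first injection to the second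
  projection. The split sequence \<open>X \<rightarrow> X \<oplus> Z \<rightarrow> Z\<close> is then literally its own dual.
\<close>

lemma graded_arrows_op:
  "graded_arrows Obj ok cd dm dg (\<lambda>a b. b \<bullet> a) add neg (\<lambda>n X Y. zer n Y X) idn
     (\<lambda>X Y. bp Y X) (\<lambda>X Y. p2 Y X) (\<lambda>X Y. p1 Y X) (\<lambda>X Y. i2 Y X) (\<lambda>X Y. i1 Y X)"
proof unfold_locales
  show "\<exists>N\<in>Obj. idn N = zer 0 N N" by (rule zero_object)
qed (use ok_Obj in \<open>simp_all add: cat add_laws add.commute bp_sum del: One_nat_def\<close>)

end

section \<open>The axioms of an extriangulated category for arrows\<close>

text \<open>
  \<open>tri X f Y g Z d\<close> stands for the triangle \<open>X \<rightarrow> Y \<rightarrow> Z\<close> with maps \<open>f, g\<close>, closed up by the degree one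
  arrow \<open>d : Z \<rightarrow> X\<close>. Reversing all arrows exchanges \<open>et3\<close> with \<open>et3_op\<close> and \<open>et4\<close> with \<open>et4_op\<close>, and
  makes each of the remaining axioms its own dual.
\<close>

locale extri_arrows = graded_arrows Obj ok dm cd dg cmp add neg zer idn bp i1 i2 p1 p2
  for Obj :: "'o set" and ok :: "'a \<Rightarrow> bool" and dm cd dg
    and cmp (infixr \<open>\<bullet>\<close> 75) and add (infixl \<open>\<uplus>\<close> 65)
    and neg zer idn bp i1 i2 p1 p2 +
  fixes tri :: "'o \<Rightarrow> 'a \<Rightarrow> 'o \<Rightarrow> 'a \<Rightarrow> 'o \<Rightarrow> 'a \<Rightarrow> bool"
  assumes tri_typing: "tri X f Y g Z d \<Longrightarrow> arr f X Y \<and> arr g Y Z \<and> extn d Z X"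
    and realize: "extn d Z X \<Longrightarrow> \<exists>f Y g. tri X f Y g Z d"
    and realize_iso: "\<lbrakk>tri X f Y g Z d; inverse_arrows h h' Y Y'\<rbrakk>
      \<Longrightarrow> tri X (h \<bullet> f) Y' (g \<bullet> h') Z d"
    and realize_mor: "\<lbrakk>tri X f Y g Z d; tri X' f' Y' g' Z' d'; arr a X X'; arr c Z Z'; a \<bullet> d = d' \<bullet> c\<rbrakk>
      \<Longrightarrow> \<exists>b. arr b Y Y' \<and> b \<bullet> f = f' \<bullet> a \<and> g' \<bullet> b = c \<bullet> g"
    and split_tri: "\<lbrakk>X \<in> Obj; Z \<in> Obj\<rbrakk> \<Longrightarrow> tri X (i1 X Z) (bp X Z) (p2 X Z) Z (zer 1 Z X)"
    and dsum_tri: "\<lbrakk>tri X f Y g Z d; tri X' f' Y' g' Z' d'\<rbrakk>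
      \<Longrightarrow> tri (bp X X') (i1 Y Y' \<bullet> f \<bullet> p1 X X' \<uplus> i2 Y Y' \<bullet> f' \<bullet> p2 X X')
           (bp Y Y') (i1 Z Z' \<bullet> g \<bullet> p1 Y Y' \<uplus> i2 Z Z' \<bullet> g' \<bullet> p2 Y Y')
           (bp Z Z') (i1 X X' \<bullet> d \<bullet> p1 Z Z' \<uplus> i2 X X' \<bullet> d' \<bullet> p2 Z Z')"
    and et3: "\<lbrakk>tri X f Y g Z d; tri X' f' Y' g' Z' d'; arr a X X'; arr b Y Y'; b \<bullet> f = f' \<bullet> a\<rbrakk>
      \<Longrightarrow> \<exists>c. arr c Z Z' \<and> g' \<bullet> b = c \<bullet> g \<and> a \<bullet> d = d' \<bullet> c"
    and et3_op: "\<lbrakk>tri X f Y g Z d; tri X' f' Y' g' Z' d'; arr b Y Y'; arr c Z Z'; c \<bullet> g = g' \<bullet> b\<rbrakk>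
      \<Longrightarrow> \<exists>a. arr a X X' \<and> b \<bullet> f = f' \<bullet> a \<and> a \<bullet> d = d' \<bullet> c"
    and et4: "\<lbrakk>tri X f Y g Z d; tri Y u V v W e\<rbrakk>
      \<Longrightarrow> \<exists>h T th w q. tri X (u \<bullet> f) V h T th \<and> tri Z w T q W (g \<bullet> e) \<and>
        w \<bullet> g = h \<bullet> u \<and> v = q \<bullet> h \<and> th \<bullet> w = d \<and> f \<bullet> th = e \<bullet> q"
    and et4_op: "\<lbrakk>tri X m V h T th; tri Z w T q W r\<rbrakk>
      \<Longrightarrow> \<exists>f Y g u e. tri X f Y g Z (th \<bullet> w) \<and> tri Y u V (q \<bullet> h) W e \<and>
        m = u \<bullet> f \<and> w \<bullet> g = h \<bullet> u \<and> g \<bullet> e = r \<and> f \<bullet> th = e \<bullet> q"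
begin

lemma extri_arrows_op:
  "extri_arrows Obj ok cd dm dg (\<lambda>a b. b \<bullet> a) add neg (\<lambda>n X Y. zer n Y X) idn
     (\<lambda>X Y. bp Y X) (\<lambda>X Y. p2 Y X) (\<lambda>X Y. p1 Y X) (\<lambda>X Y. i2 Y X) (\<lambda>X Y. i1 Y X)
     (\<lambda>X f Y g Z d. tri Z g Y f X d)"
proof (intro extri_arrows.intro graded_arrows_op extri_arrows_axioms.intro, goal_cases)
  case 1 from tri_typing[OF 1] show ?case by auto
next
  case 2 then show ?case using realize by blast
next
  case 3 then show ?case using realize_iso by blast
next
  case 4 show ?case using realize_mor[OF 4(2,1)] 4(3-) by metis
next
  case 5 then show ?case using split_tri by blast
next
  case 6
  note [simp] = tri_typing[OF 6(1)] tri_typing[OF 6(2)]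
  show ?case using dsum_tri[OF 6(2,1)] by (simp add: cat add_comm)
next
  case 7 show ?case using et3_op[OF 7(2,1)] 7(3-) by metis
next
  case 8 show ?case using et3[OF 8(2,1)] 8(3-) by metis
next
  case 9 from et4_op[OF 9(2,1)] show ?case by (metis (no_types))
next
  case 10 from et4[OF 10(2,1)] show ?case by (metis (no_types))
qed

section \<open>Exact sequences of a triangle\<close>

text \<open>
  (ET3) compares the split triangle \<open>X \<rightarrow> X \<oplus> 0 \<rightarrow> 0\<close> with the given one, via \<open>(1, f)\<close>: the third
  map starts at a zero object. The same device, with a zero object at the other end
  or for (ET3)\<open>\<^sup>o\<^sup>p\<close>, gives \<open>tri_ext_cmp_zer\<close> and \<open>lift_middle\<close>.
\<close>

lemma tri_cmp_zer:
  assumes t: "tri X f Y g Z d"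
  shows "g \<bullet> f = zer 0 X Z"
proof -
  note [simp] = tri_typing[OF t]
  obtain N where [simp]: "N \<in> Obj" using zero_object by auto
  have "(f \<bullet> p1 X N) \<bullet> i1 X N = f \<bullet> idn X" by (simp add: cat)
  then obtain c where c: "arr c N Z" "g \<bullet> f \<bullet> p1 X N = c \<bullet> p2 X N"
    using et3[OF split_tri[of X N] t, of "idn X" "f \<bullet> p1 X N"] by (auto simp: cat)
  have "g \<bullet> f = (g \<bullet> f \<bullet> p1 X N) \<bullet> i1 X N" by (simp add: cat)
  also have "\<dots> = zer 0 X Z" unfolding c(2) using c(1) by (simp add: cat)
  finally show ?thesis .
qed

lemma tri_ext_cmp_zer:
  assumes t: "tri X f Y g Z d"
  shows "d \<bullet> g = zer 1 Y X"
proof -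
  note [simp] = tri_typing[OF t]
  obtain N where [simp]: "N \<in> Obj" using zero_object by auto
  obtain a where a: "arr a N X" "a \<bullet> zer 1 Y N = d \<bullet> g"
    using et3_op[OF split_tri[of N Y] t, of "p2 N Y" g] by (auto simp: cat)
  then show ?thesis by (simp add: cat)
qed

lemma lift_middle:
  assumes t: "tri X f Y g Z d" and u: "arr u W Y" "g \<bullet> u = zer 0 W Z"
  obtains x where "arr x W X" "f \<bullet> x = u"
proof -
  note [simp] = tri_typing[OF t] u(1)
  obtain N where [simp]: "N \<in> Obj" using zero_object by auto
  have "zer 0 N Z \<bullet> p2 W N = g \<bullet> (u \<bullet> p1 W N)"
    by (simp add: cat reassoc[OF u(2)])
  then obtain x where x: "arr x W X" "u \<bullet> p1 W N \<bullet> i1 W N = f \<bullet> x"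
    using et3_op[OF split_tri[of W N] t, of "u \<bullet> p1 W N" "zer 0 N Z"] by (auto simp: cat)
  show thesis using that[OF x(1)] x(2) by (simp add: cat)
qed

text \<open>
  The vanishing of \<open>d \<bullet> w\<close> says that \<open>(0, w)\<close> is a morphism from the zero extension of \<open>W\<close> by a zero
  object to \<open>d\<close>; its realization restricts to a lift of \<open>w\<close>.
\<close>

lemma lift_right:
  assumes t: "tri X f Y g Z d" and w: "arr w W Z" "d \<bullet> w = zer 1 W X"
  obtains y where "arr y W Y" "g \<bullet> y = w"
proof -
  note [simp] = tri_typing[OF t] w(1)
  obtain N where [simp]: "N \<in> Obj" using zero_object by auto
  have "zer 0 N X \<bullet> zer 1 W N = d \<bullet> w" by (simp add: cat w(2))
  then obtain b where b: "arr b (bp N W) Y" "g \<bullet> b = w \<bullet> p2 N W"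
    using realize_mor[OF split_tri[of N W] t, of "zer 0 N X" w] by (auto simp: cat)
  show thesis using that[of "b \<bullet> i2 N W"] b by (simp add: cat reassoc[OF b(2)])
qed

text \<open>
  Realizing \<open>x\<close> itself by a triangle \<open>V \<rightarrow> Y' \<rightarrow> Z\<close> turns the condition \<open>x \<bullet> g = 0\<close> into a lift of \<open>g\<close>
  to \<open>Y'\<close>, and (ET3)\<open>\<^sup>o\<^sup>p\<close> with the identity of \<open>Z\<close> produces the map \<open>X \<rightarrow> V\<close>.
\<close>

lemma extend_ext:
  assumes t: "tri X f Y g Z d" and x: "extn x Z V" "x \<bullet> g = zer 1 Y V"
  obtains a where "arr a X V" "a \<bullet> d = x"
proof -
  note [simp] = tri_typing[OF t] x(1)
  obtain f' Y' g' where t': "tri V f' Y' g' Z x" using realize x(1) by blast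
  note [simp] = tri_typing[OF t']
  obtain b where b: "arr b Y Y'" "g' \<bullet> b = g" using lift_right[OF t' _ x(2)] by auto
  obtain a where "arr a X V" "a \<bullet> d = x \<bullet> idn Z"
    using et3_op[OF t t', of b "idn Z"] b by (auto simp: cat)
  then show thesis using that by (simp add: cat)
qed

text \<open>
  The surjectivity half of the five lemma for maps from \<open>Y'\<close>, applied to the identity. Since \<open>f\<close> need not be
  monic, the injectivity half fails in this sequence; the left inverse comes from the dual sequence.
\<close>

lemma middle_right_inverse:
  assumes t: "tri X f Y g Z d" and t': "tri X' f' Y' g' Z' d'"
    and a: "inverse_arrows a a' X X'" and b: "arr b Y Y'" and c: "inverse_arrows c c' Z Z'"
    and eqs: "b \<bullet> f = f' \<bullet> a" "g' \<bullet> b = c \<bullet> g" "a \<bullet> d = d' \<bullet> c"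
  obtains r where "arr r Y' Y" "b \<bullet> r = idn Y'"
proof -
  note [simp] = tri_typing[OF t] tri_typing[OF t'] a b c
  have "a \<bullet> d \<bullet> c' \<bullet> g' = zer 1 Y' X'"
    using tri_ext_cmp_zer[OF t'] eqs(3) by (simp add: cat reassoc[OF eqs(3)] reassoc[of c c'])
  then have "a' \<bullet> a \<bullet> d \<bullet> c' \<bullet> g' = zer 1 Y' X" by (simp add: cat)
  then have "d \<bullet> (c' \<bullet> g') = zer 1 Y' X" by (simp add: cat reassoc[of a' a])
  then obtain y where y: "arr y Y' Y" "g \<bullet> y = c' \<bullet> g'"
    using lift_right[OF t, of "c' \<bullet> g'" Y'] by (auto simp: cat)
  have "g' \<bullet> (idn Y' \<uplus> neg (b \<bullet> y)) = zer 0 Y' Z'"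
    using y(1) by (simp add: cat add_laws reassoc[OF eqs(2)] y(2) reassoc[of c c'])
  then obtain x where x: "arr x Y' X'" "f' \<bullet> x = idn Y' \<uplus> neg (b \<bullet> y)"
    using lift_middle[OF t', of "idn Y' \<uplus> neg (b \<bullet> y)" Y'] y(1) by (auto simp: cat)
  have "b \<bullet> (y \<uplus> f \<bullet> a' \<bullet> x) = idn Y'"
    using x(1) y(1) by (simp add: cat add_laws reassoc[OF eqs(1)] reassoc[of a a'] x(2))
  then show thesis using that[of "y \<uplus> f \<bullet> a' \<bullet> x"] x(1) y(1) by (simp add: cat)
qed

section \<open>Five lemmas and isomorphic triangles\<close>

context
begin

interpretation op: extri_arrows Obj ok cd dm dg "\<lambda>a b. b \<bullet> a" add neg "\<lambda>n X Y. zer n Y X" idn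
  "\<lambda>X Y. bp Y X" "\<lambda>X Y. p2 Y X" "\<lambda>X Y. p1 Y X" "\<lambda>X Y. i2 Y X" "\<lambda>X Y. i1 Y X"
  "\<lambda>X f Y g Z d. tri Z g Y f X d"
  by (rule extri_arrows_op)

lemma cmp_ext_zer: "tri X f Y g Z d \<Longrightarrow> f \<bullet> d = zer 1 Z Y"
  by (rule op.tri_ext_cmp_zer)

lemma extend_middle:
  assumes t: "tri X f Y g Z d" and v: "arr v Y W" "v \<bullet> f = zer 0 X W"
  obtains z where "arr z Z W" "z \<bullet> g = v"
  by (rule op.lift_middle[OF t, of v W]) (use v that in auto)

lemma extend_left:
  assumes t: "tri X f Y g Z d" and v: "arr v X W" "v \<bullet> d = zer 1 Z W"
  obtains y where "arr y Y W" "y \<bullet> f = v"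
  by (rule op.lift_right[OF t, of v W]) (use v that in auto)

lemma lift_ext:
  assumes t: "tri X f Y g Z d" and x: "extn x W X" "f \<bullet> x = zer 1 W Y"
  obtains z where "arr z W Z" "d \<bullet> z = x"
  by (rule op.extend_ext[OF t, of x W]) (use x that in auto)

lemma middle_left_inverse:
  assumes t: "tri X f Y g Z d" and t': "tri X' f' Y' g' Z' d'"
    and a: "inverse_arrows a a' X X'" and b: "arr b Y Y'" and c: "inverse_arrows c c' Z Z'"
    and eqs: "b \<bullet> f = f' \<bullet> a" "g' \<bullet> b = c \<bullet> g" "a \<bullet> d = d' \<bullet> c"
  obtains r where "arr r Y' Y" "r \<bullet> b = idn Y"
  by (rule op.middle_right_inverse[OF t' t, of c c' b a a']) (use assms that in auto)

end

lemma five_lemma_middle: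
  assumes t: "tri X f Y g Z d" and t': "tri X' f' Y' g' Z' d'"
    and a: "inverse_arrows a a' X X'" and b: "arr b Y Y'" and c: "inverse_arrows c c' Z Z'"
    and eqs: "b \<bullet> f = f' \<bullet> a" "g' \<bullet> b = c \<bullet> g" "a \<bullet> d = d' \<bullet> c"
  obtains b' where "inverse_arrows b b' Y Y'"
proof -
  obtain r where r: "arr r Y' Y" "b \<bullet> r = idn Y'" using middle_right_inverse[OF assms] by metis
  obtain l where l: "arr l Y' Y" "l \<bullet> b = idn Y" using middle_left_inverse[OF assms] by metis
  have "l = l \<bullet> (b \<bullet> r)" using l(1) r(2) by (simp add: cat)
  also have "\<dots> = r" using l r(1) b by (simp add: reassoc[OF l(2)] cat)
  finally show thesis using that[of r] r l b by simp
qed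

lemma realization_unique:
  assumes t: "tri X f Y g Z d" and t': "tri X f' Y' g' Z d"
  obtains h h' where "inverse_arrows h h' Y Y'" "h \<bullet> f = f'" "g' \<bullet> h = g" "g \<bullet> h' = g'"
proof -
  note [simp] = tri_typing[OF t] tri_typing[OF t']
  obtain h where h: "arr h Y Y'" "h \<bullet> f = f'" "g' \<bullet> h = g"
    using realize_mor[OF t t', of "idn X" "idn Z"] by (auto simp: cat)
  obtain h' where h': "inverse_arrows h h' Y Y'"
    using five_lemma_middle[OF t t' _ h(1), of "idn X" "idn X" "idn Z" "idn Z"] h(2,3) by (auto simp: cat)
  have "g \<bullet> h' = (g' \<bullet> h) \<bullet> h'" by (simp only: h(3))
  also have "\<dots> = g'" using h' by (simp add: cat)
  finally show thesis using that h' h(2,3) by blast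
qed

text \<open>
  The sequence of maps into the triangle is exact at \<open>Y\<close>, at \<open>Z\<close> and at the extensions by \<open>X\<close>, which is
  enough for both halves of the five lemma at \<open>Z\<close>: a right inverse of \<open>c\<close> exists, and \<open>c\<close> is
  cancellable, so the right inverse is two-sided.
\<close>

lemma five_lemma_right:
  assumes t: "tri X f Y g Z d" and t': "tri X' f' Y' g' Z' d'"
    and a: "inverse_arrows a a' X X'" and b: "inverse_arrows b b' Y Y'" and c: "arr c Z Z'"
    and eqs: "b \<bullet> f = f' \<bullet> a" "g' \<bullet> b = c \<bullet> g" "a \<bullet> d = d' \<bullet> c"
  obtains c' where "inverse_arrows c c' Z Z'"
proof -
  note [simp] = tri_typing[OF t] tri_typing[OF t'] a b c
  have "b \<bullet> (f \<bullet> (a' \<bullet> d')) = zer 1 Z' Y'"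
    by (simp add: cat reassoc[OF eqs(1)] reassoc[of a a'] cmp_ext_zer[OF t'])
  then have "b' \<bullet> b \<bullet> (f \<bullet> (a' \<bullet> d')) = zer 1 Z' Y" by (simp add: cat)
  then have "f \<bullet> (a' \<bullet> d') = zer 1 Z' Y" by (simp add: cat reassoc[of b' b])
  then obtain z where z: "arr z Z' Z" "d \<bullet> z = a' \<bullet> d'"
    using lift_ext[OF t, of "a' \<bullet> d'" Z'] by (auto simp: cat)
  have "d' \<bullet> (idn Z' \<uplus> neg (c \<bullet> z)) = zer 1 Z' X'"
    using z(1) by (simp add: cat add_laws reassoc[OF eqs(3)[symmetric]] z(2) reassoc[of a a'])
  then obtain y where y: "arr y Z' Y'" "g' \<bullet> y = idn Z' \<uplus> neg (c \<bullet> z)"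
    using lift_right[OF t', of "idn Z' \<uplus> neg (c \<bullet> z)" Z'] z(1) by (auto simp: cat)
  define r where "r = z \<uplus> g \<bullet> b' \<bullet> y"
  have r: "arr r Z' Z" using z(1) y(1) by (simp add: r_def cat)
  have cr: "c \<bullet> r = idn Z'"
    using y(1) z(1)
    by (simp add: r_def cat add_laws reassoc[OF eqs(2)[symmetric]] reassoc[of b b'] y(2))
  \<comment> \<open>Uniqueness half: a map killed by c factors through g, and chasing it back to X
    shows that it vanishes.\<close>
  have mono: "e = zer 0 Z Z" if e: "arr e Z Z" "c \<bullet> e = zer 0 Z Z'" for e
  proof -
    note [simp] = e(1)
    have "a \<bullet> (d \<bullet> e) = zer 1 Z X'" by (simp add: cat reassoc[OF eqs(3)] e(2))
    then have "a' \<bullet> a \<bullet> (d \<bullet> e) = zer 1 Z X" by (simp add: cat)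
    then have "d \<bullet> e = zer 1 Z X" by (simp add: cat reassoc[of a' a])
    then obtain y where y: "arr y Z Y" "g \<bullet> y = e" using lift_right[OF t e(1)] by metis
    have "g' \<bullet> (b \<bullet> y) = zer 0 Z Z'" using y(1) by (simp add: reassoc[OF eqs(2)] cat y(2) e(2))
    then obtain x where x: "arr x Z X'" "f' \<bullet> x = b \<bullet> y"
      using lift_middle[OF t', of "b \<bullet> y" Z] y(1) by (auto simp: cat)
    have "y = b' \<bullet> (b \<bullet> y)" using y(1) by (simp add: cat reassoc[of b' b])
    also have "b \<bullet> y = b \<bullet> (f \<bullet> (a' \<bullet> x))"
      using x by (simp add: cat reassoc[OF eqs(1)] reassoc[of a a'])
    also have "b' \<bullet> \<dots> = f \<bullet> (a' \<bullet> x)" using x(1) by (simp add: cat reassoc[of b' b])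
    finally have "e = g \<bullet> (f \<bullet> (a' \<bullet> x))" using y(2) by simp
    then show ?thesis using x(1) by (simp add: cat reassoc[OF tri_cmp_zer[OF t]])
  qed
  have "r \<bullet> c \<uplus> neg (idn Z) = zer 0 Z Z"
    using r by (intro mono) (simp_all add: cat add_laws reassoc[OF cr])
  then have "r \<bullet> c = idn Z" by (rule sub_eq_zer) (use r in \<open>simp_all add: cat\<close>)
  then show thesis using that[of r] r cr c by simp
qed

text \<open>
  The extension \<open>d'\<close> has some realization; the morphism from the old triangle to it has
  an invertible middle map, and comparing this map with \<open>b\<close> shows that the new sequence is
  equivalent to that realization.
\<close>

lemma tri_transport:
  assumes t: "tri X f Y g Z d"
    and a: "inverse_arrows a a' X X'" and b: "inverse_arrows b b' Y Y'" and c: "inverse_arrows c c' Z Z'"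
    and ty: "arr f' X' Y'" "arr g' Y' Z'" "extn d' Z' X'"
    and eqs: "b \<bullet> f = f' \<bullet> a" "g' \<bullet> b = c \<bullet> g" "a \<bullet> d = d' \<bullet> c"
  shows "tri X' f' Y' g' Z' d'"
proof -
  obtain f'' Y'' g'' where t'': "tri X' f'' Y'' g'' Z' d'" using realize ty(3) by blast
  note [simp] = tri_typing[OF t] tri_typing[OF t''] a b c ty
  obtain h where h: "arr h Y Y''" "h \<bullet> f = f'' \<bullet> a" "g'' \<bullet> h = c \<bullet> g"
    using realize_mor[OF t t'', of a c] eqs(3) by auto
  obtain h' where h': "inverse_arrows h h' Y Y''"
    using five_lemma_middle[OF t t'' a h(1) c h(2,3) eqs(3)] by metis
  note [simp] = h'
  have "tri X' ((b \<bullet> h') \<bullet> f'') Y' (g'' \<bullet> (h \<bullet> b')) Z' d'"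
    using realize_iso[OF t'', where h="b \<bullet> h'" and h'="h \<bullet> b'" and Y'=Y']
    by (simp add: cat reassoc[of h' h] reassoc[of b' b])
  moreover have "(b \<bullet> h') \<bullet> f'' = f'"
  proof -
    have "f'' = h \<bullet> f \<bullet> a'" by (simp add: reassoc[OF h(2)] cat)
    then show ?thesis by (simp add: cat reassoc[of h' h] reassoc[OF eqs(1)])
  qed
  moreover have "g'' \<bullet> (h \<bullet> b') = g'"
    by (simp add: reassoc[OF h(3)] cat reassoc[OF eqs(2)[symmetric]])
  ultimately show ?thesis by simp
qed

lemma cone_unique:
  assumes t: "tri X f Y g Z d" and t': "tri X f Y g' Z' d'"
  obtains c c' where "inverse_arrows c c' Z Z'" "c \<bullet> g = g'" "d' \<bullet> c = d"
proof -
  note [simp] = tri_typing[OF t] tri_typing[OF t']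
  obtain c where c: "arr c Z Z'" "g' = c \<bullet> g" "d = d' \<bullet> c"
    using et3[OF t t', of "idn X" "idn Y"] by (auto simp: cat)
  obtain c' where "inverse_arrows c c' Z Z'"
    using five_lemma_right[OF t t', of "idn X" "idn X" "idn Y" "idn Y" c] c by (auto simp: cat)
  then show thesis using that c by auto
qed

context
begin

interpretation op: extri_arrows Obj ok cd dm dg "\<lambda>a b. b \<bullet> a" add neg "\<lambda>n X Y. zer n Y X" idn
  "\<lambda>X Y. bp Y X" "\<lambda>X Y. p2 Y X" "\<lambda>X Y. p1 Y X" "\<lambda>X Y. i2 Y X" "\<lambda>X Y. i1 Y X"
  "\<lambda>X f Y g Z d. tri Z g Y f X d"
  by (rule extri_arrows_op)

lemma cocone_unique:
  assumes t: "tri X f Y g Z d" and t': "tri X' f' Y g Z d'"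
  obtains a a' where "inverse_arrows a a' X X'" "f' \<bullet> a = f" "a \<bullet> d = d'"
proof -
  obtain c c' where "inverse_arrows c c' X' X" "f \<bullet> c = f'" "c \<bullet> d' = d"
    using op.cone_unique[OF t t'] by metis
  note c = this
  note [simp] = c(1) tri_typing[OF t] tri_typing[OF t']
  have "f' \<bullet> c' = f" "c' \<bullet> d = d'"
    by (simp_all add: c(2,3)[symmetric] cat reassoc[of c c'] reassoc[of c' c])
  then show thesis using that[of c' c] by simp
qed

end

lemma split_tri':
  assumes [simp]: "X \<in> Obj" "Z \<in> Obj"
  shows "tri Z (i2 X Z) (bp X Z) (p1 X Z) X (zer 1 X Z)"
proof -
  let ?s = "i2 X Z \<bullet> p1 Z X \<uplus> i1 X Z \<bullet> p2 Z X" and ?s' = "i2 Z X \<bullet> p1 X Z \<uplus> i1 Z X \<bullet> p2 X Z"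
  have "?s' \<bullet> ?s = idn (bp Z X)" "?s \<bullet> ?s' = idn (bp X Z)"
    by (simp_all add: cat bp_sum[symmetric] add_comm)
  then show ?thesis
    by (intro tri_transport[OF split_tri[of Z X], where a="idn Z" and a'="idn Z" and b="?s" and b'="?s'"
      and c="idn X" and c'="idn X"]) (simp_all add: cat)
qed

text \<open>
  The direct sum with the triangle \<open>V \<rightarrow> V \<oplus> 0 \<rightarrow> 0\<close> has the superfluous zero summands in the
  second and third terms, which are removed along the obvious isomorphisms.
\<close>

lemma stabilize:
  assumes t: "tri X f Y g Z d" and V[simp]: "V \<in> Obj"
  shows "tri (bp X V) (i1 Y V \<bullet> f \<bullet> p1 X V \<uplus> i2 Y V \<bullet> p2 X V) (bp Y V) (g \<bullet> p1 Y V) Z (i1 X V \<bullet> d)"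
proof -
  note [simp] = tri_typing[OF t]
  obtain N where [simp]: "N \<in> Obj" and N: "idn N = zer 0 N N" using zero_object by auto
  have p2N: "p2 W N = zer 0 (bp W N) N" if "W \<in> Obj" for W
    using arrow_into_zero_object[OF _ N, of "p2 W N"] that by (simp add: cat)
  have i1p1: "i1 W N \<bullet> p1 W N = idn (bp W N)" if "W \<in> Obj" for W
    using bp_sum[of W N] that by (simp add: p2N cat)
  let ?b = "i1 Y V \<bullet> p1 Y (bp V N) \<uplus> i2 Y V \<bullet> p1 V N \<bullet> p2 Y (bp V N)"
  let ?b' = "i1 Y (bp V N) \<bullet> p1 Y V \<uplus> i2 Y (bp V N) \<bullet> i1 V N \<bullet> p2 Y V"
  have "inverse_arrows ?b ?b' (bp Y (bp V N)) (bp Y V)"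
    by (simp add: cat bp_sum reassoc[OF i1p1])
  moreover have "inverse_arrows (p1 Z N) (i1 Z N) (bp Z N) Z"
    by (simp add: cat i1p1)
  ultimately show ?thesis
    by (intro tri_transport[OF dsum_tri[OF t split_tri[of V N]], where a="idn (bp X V)" and a'="idn (bp X V)"
      and b="?b" and b'="?b'" and c="p1 Z N" and c'="i1 Z N"]) (simp_all add: cat)
qed

section \<open>Homotopy pushouts and pullbacks\<close>

text \<open>
  The map \<open>(f, a) : X \<rightarrow> Y \<oplus> V\<close> is the composite of the split inflation \<open>(1, a) : X \<rightarrow> X \<oplus> V\<close>, with cone
  \<open>(a, -1) : X \<oplus> V \<rightarrow> V\<close>, and of \<open>f \<oplus> 1\<close>. (ET4) computes its cone as a realization of \<open>a \<bullet> d\<close>, hence as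
  the given \<open>E\<close>.
\<close>

lemma pushout_square:
  assumes t: "tri X f Y g Z d" and a: "arr a X V" and st: "tri V s E t Z (a \<bullet> d)"
  obtains b where "arr b Y E" "b \<bullet> f = s \<bullet> a" "t \<bullet> b = g"
    "tri X (i1 Y V \<bullet> f \<uplus> i2 Y V \<bullet> a) (bp Y V) (b \<bullet> p1 Y V \<uplus> neg s \<bullet> p2 Y V) E (d \<bullet> t)"
proof -
  note [simp] = tri_typing[OF t] a tri_typing[OF st]
  let ?k = "i1 X V \<uplus> i2 X V \<bullet> a" and ?l = "a \<bullet> p1 X V \<uplus> neg (p2 X V)"
  let ?F = "i1 Y V \<bullet> f \<bullet> p1 X V \<uplus> i2 Y V \<bullet> p2 X V"
  \<comment> \<open>The automorphism (x, v) \<mapsto> (x, a x - v) is an involution that carries the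
    standard split triangle to the one with maps k and l.\<close>
  let ?x = "i1 X V \<bullet> p1 X V \<uplus> (i2 X V \<bullet> a \<bullet> p1 X V \<uplus> neg (i2 X V \<bullet> p2 X V))"
  have "?x \<bullet> ?x = idn (bp X V)"
    by (simp add: cat add_laws bp_sum[symmetric])
  then have kl: "tri X ?k (bp X V) ?l V (zer 1 V X)"
    by (intro tri_transport[OF split_tri[of X V], where a="idn X" and a'="idn X" and b="?x" and b'="?x"
      and c="idn V" and c'="idn V"]) (simp_all add: cat add_laws)
  obtain h th W w q where h: "tri X (?F \<bullet> ?k) (bp Y V) h W th" "tri V w W q Z (?l \<bullet> i1 X V \<bullet> d)"
    "w \<bullet> ?l = h \<bullet> ?F" "g \<bullet> p1 Y V = q \<bullet> h" "?k \<bullet> th = (i1 X V \<bullet> d) \<bullet> q"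
    using et4[OF kl stabilize[OF t, of V]] by auto
  note [simp] = tri_typing[OF h(1)] tri_typing[OF h(2)]
  have tri_w: "tri V w W q Z (a \<bullet> d)" using h(2) by (simp add: cat)
  obtain j j' where inv: "inverse_arrows j j' W E" and j: "j \<bullet> w = s" "t \<bullet> j = q"
    using realization_unique[OF tri_w st] by metis
  note [simp] = inv
  have "p1 X V \<bullet> ?k \<bullet> th = p1 X V \<bullet> (i1 X V \<bullet> d) \<bullet> q" by (simp only: h(5))
  then have th: "th = d \<bullet> q" by (simp add: cat)
  have "(h \<bullet> ?F) \<bullet> i2 X V = (w \<bullet> ?l) \<bullet> i2 X V" by (simp only: h(3))
  then have h2: "h \<bullet> i2 Y V = neg w" by (simp add: cat)
  have "(h \<bullet> ?F) \<bullet> i1 X V = (w \<bullet> ?l) \<bullet> i1 X V" by (simp only: h(3))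
  then have h1: "h \<bullet> (i1 Y V \<bullet> f) = w \<bullet> a" by (simp add: cat)
  let ?b = "j \<bullet> h \<bullet> i1 Y V"
  have "j \<bullet> h = ?b \<bullet> p1 Y V \<uplus> neg s \<bullet> p2 Y V"
    by (rule biproduct_eqI[of Y V]) (simp_all add: cat h2 j)
  then have "tri X (i1 Y V \<bullet> f \<uplus> i2 Y V \<bullet> a) (bp Y V) (?b \<bullet> p1 Y V \<uplus> neg s \<bullet> p2 Y V) E (d \<bullet> t)"
    by (intro tri_transport[OF h(1), where a="idn X" and a'="idn X" and b="idn (bp Y V)" and b'="idn (bp Y V)"
      and c="j" and c'="j'"]) (simp_all add: cat th j)
  moreover have "?b \<bullet> f = s \<bullet> a" by (simp add: cat h1 reassoc[OF j(1)])
  moreover have "t \<bullet> ?b = g"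
    by (simp add: cat reassoc[OF j(2)] reassoc[OF h(4)[symmetric]])
  ultimately show thesis using that[of ?b] by (simp add: cat)
qed

context
begin

interpretation op: extri_arrows Obj ok cd dm dg "\<lambda>a b. b \<bullet> a" add neg "\<lambda>n X Y. zer n Y X" idn
  "\<lambda>X Y. bp Y X" "\<lambda>X Y. p2 Y X" "\<lambda>X Y. p1 Y X" "\<lambda>X Y. i2 Y X" "\<lambda>X Y. i1 Y X"
  "\<lambda>X f Y g Z d. tri Z g Y f X d"
  by (rule extri_arrows_op)

lemma pullback_square:
  assumes t: "tri X f Y g Z d" and c: "arr c V Z" and st: "tri X s E t V (d \<bullet> c)"
  obtains b where "arr b E Y" "g \<bullet> b = c \<bullet> t" "b \<bullet> s = f"
    "tri E (i1 V Y \<bullet> neg t \<uplus> i2 V Y \<bullet> b) (bp V Y) (c \<bullet> p1 V Y \<uplus> g \<bullet> p2 V Y) Z (s \<bullet> d)"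
proof -
  note [simp] = tri_typing[OF t] c tri_typing[OF st]
  show thesis
    by (rule op.pushout_square[OF t, of c V s E t]) (use c st that in \<open>auto simp: cat add_comm\<close>)
qed

end

text \<open>
  The square of \<open>b\<close> is also a pushout of \<open>k\<close> along \<open>f\<close>: the two pushouts are cones of the same inflation
  \<open>X \<rightarrow> Y \<oplus> V\<close>, up to the exchange of the summands and the sign that this exchange causes.
\<close>

lemma inflation_of_pushout:
  assumes t: "tri X f Y g Z d" and k: "tri X k V p C e" and st: "tri V s E t Z (k \<bullet> d)"
    and b: "arr b Y E"
    and sq: "tri X (i1 Y V \<bullet> f \<uplus> i2 Y V \<bullet> k) (bp Y V) (b \<bullet> p1 Y V \<uplus> neg s \<bullet> p2 Y V) E (d \<bullet> t)"
  obtains r where "tri Y b E r C (f \<bullet> e)" "r \<bullet> s = p"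
proof -
  note [simp] = tri_typing[OF t] tri_typing[OF k] tri_typing[OF st] b
  obtain s' F q where F: "tri Y s' F q C (f \<bullet> e)"
    using realize[of "f \<bullet> e" C Y] by (auto simp: cat)
  note [simp] = tri_typing[OF F]
  obtain b' where b': "arr b' V F" "b' \<bullet> k = s' \<bullet> f" "q \<bullet> b' = p"
    and sq': "tri X (i1 V Y \<bullet> k \<uplus> i2 V Y \<bullet> f) (bp V Y) (b' \<bullet> p1 V Y \<uplus> neg s' \<bullet> p2 V Y) F (e \<bullet> q)"
    using pushout_square[OF k _ F] by auto
  note [simp] = b'(1)
  have "tri X (i1 Y V \<bullet> f \<uplus> i2 Y V \<bullet> k) (bp Y V) (s' \<bullet> p1 Y V \<uplus> neg b' \<bullet> p2 Y V) F (neg (e \<bullet> q))"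
    by (intro tri_transport[OF sq', where a="idn X" and a'="idn X" and c="neg (idn F)" and c'="neg (idn F)"
       and b="i1 Y V \<bullet> p2 V Y \<uplus> i2 Y V \<bullet> p1 V Y" and b'="i1 V Y \<bullet> p2 Y V \<uplus> i2 V Y \<bullet> p1 Y V"])
      (simp_all add: cat add_laws bp_sum[symmetric])
  from cone_unique[OF this sq] obtain j j' where j: "inverse_arrows j j' F E"
     "j \<bullet> (s' \<bullet> p1 Y V \<uplus> neg b' \<bullet> p2 Y V) = b \<bullet> p1 Y V \<uplus> neg s \<bullet> p2 Y V" by metis
  note [simp] = j(1)
  have "(j \<bullet> (s' \<bullet> p1 Y V \<uplus> neg b' \<bullet> p2 Y V)) \<bullet> i1 Y V = (b \<bullet> p1 Y V \<uplus> neg s \<bullet> p2 Y V) \<bullet> i1 Y V"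
    by (simp only: j(2))
  then have js: "j \<bullet> s' = b" by (simp add: cat)
  have "neg ((j \<bullet> (s' \<bullet> p1 Y V \<uplus> neg b' \<bullet> p2 Y V)) \<bullet> i2 Y V) = neg ((b \<bullet> p1 Y V \<uplus> neg s \<bullet> p2 Y V) \<bullet> i2 Y V)"
    by (simp only: j(2))
  then have jb: "j \<bullet> b' = s" by (simp add: cat)
  have "tri Y b E (q \<bullet> j') C (f \<bullet> e)"
    by (intro tri_transport[OF F, where a="idn Y" and a'="idn Y" and b=j and b'=j' and c="idn C" and c'="idn C"])
      (simp_all add: cat js reassoc[of j' j])
  moreover have "(q \<bullet> j') \<bullet> s = p"
    by (simp add: jb[symmetric] cat reassoc[of j' j] b'(3))
  ultimately show thesis by (rule that)
qed

text \<open>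
  A triangle with zero extension is isomorphic to a split one, and the isomorphism can be chosen with a
  prescribed retraction \<open>r\<close> as one component. The point is that \<open>r\<close> becomes a deflation, which is not
  automatic for a retraction in a category without split idempotents.
\<close>

lemma complement_of_retract:
  assumes t: "tri X w W q Z (zer 1 Z X)" and r: "arr r W X" "r \<bullet> w = idn X"
  obtains v where "tri Z v W r X (zer 1 X Z)" "q \<bullet> v = idn Z" "w \<bullet> r \<uplus> v \<bullet> q = idn W"
proof -
  note [simp] = tri_typing[OF t] r(1)
  let ?j = "i2 Z X \<bullet> r \<uplus> i1 Z X \<bullet> q"
  have "?j \<bullet> w = i2 Z X" by (simp add: cat r(2) tri_cmp_zer[OF t])
  then obtain j' where j': "inverse_arrows ?j j' W (bp Z X)"
    using five_lemma_middle[OF t split_tri'[of Z X], of "idn X" "idn X" ?j "idn Z" "idn Z"]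
    by (auto simp: cat)
  note [simp] = j'[THEN conjunct2, THEN conjunct1]
  have jj: "?j \<bullet> j' = idn (bp Z X)" "j' \<bullet> ?j = idn W" using j' by auto
  have "p1 Z X \<bullet> ?j \<bullet> j' = p1 Z X" "p2 Z X \<bullet> ?j \<bullet> j' = p2 Z X" by (simp_all only: jj) (simp_all add: cat)
  then have qr: "q \<bullet> j' = p1 Z X" "r \<bullet> j' = p2 Z X" by (simp_all add: cat)
  have "w = j' \<bullet> i2 Z X"
  proof -
    have "w = (j' \<bullet> ?j) \<bullet> w" by (simp only: jj) (simp add: cat)
    also have "\<dots> = j' \<bullet> (?j \<bullet> w)" by (rule cmp_assoc) (simp_all add: cat)
    finally show ?thesis by (simp only: \<open>?j \<bullet> w = i2 Z X\<close>)
  qed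
  then have "w \<bullet> r \<uplus> (j' \<bullet> i1 Z X) \<bullet> q = j' \<bullet> ?j" by (simp add: cat)
  moreover have "tri Z (j' \<bullet> i1 Z X) W r X (zer 1 X Z)"
    by (intro tri_transport[OF split_tri[of Z X], where a="idn Z" and a'="idn Z" and b=j' and b'="?j"
          and c="idn X" and c'="idn X"]) (use j' in \<open>simp_all add: cat qr\<close>)
  moreover have "q \<bullet> (j' \<bullet> i1 Z X) = idn Z" by (simp add: reassoc[OF qr(1)] cat)
  ultimately show thesis using that jj by metis
qed

text \<open>
  The composite of \<open>E \<rightarrow> A \<oplus> B\<close> with the inflation \<open>(a, b') \<mapsto> (i a + g b', b')\<close> into \<open>Y \<oplus> B\<close> is \<open>(0, b)\<close>. Its
  cone \<open>F\<close> from (ET4) is an extension of \<open>C\<close> by \<open>Y\<close> of class \<open>i \<bullet> e = 0\<close>, so it splits. After the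
  splitting is adjusted to be compatible with the summand \<open>Y\<close> of \<open>Y \<oplus> B\<close>, that summand is cancelled
  by (ET4)\<open>\<^sup>o\<^sup>p\<close>.
\<close>

lemma inflation_of_pullback:
  assumes t: "tri E (i1 A B \<bullet> neg t \<uplus> i2 A B \<bullet> b) (bp A B) (i \<bullet> p1 A B \<uplus> g \<bullet> p2 A B) Y d"
    and i: "tri A i Y p C e" and ty: "arr t E A" "arr b E B" "arr g B Y"
  obtains r where "tri E b B (p \<bullet> g) C r" "t \<bullet> r = e" "r \<bullet> p = d"
proof -
  note [simp] = tri_typing[OF i] ty
  let ?m = "i1 A B \<bullet> neg t \<uplus> i2 A B \<bullet> b"
  let ?u = "i1 Y B \<bullet> i \<bullet> p1 A B \<uplus> (i1 Y B \<bullet> g \<bullet> p2 A B \<uplus> i2 Y B \<bullet> p2 A B)"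
  let ?v = "p \<bullet> p1 Y B \<uplus> neg (p \<bullet> g \<bullet> p2 Y B)"
  have d: "extn d Y E" using tri_typing[OF t] by simp
  note [simp] = d
  have gb: "g \<bullet> b = i \<bullet> t"
  proof (rule sub_eq_zer)
    show "g \<bullet> b \<uplus> neg (i \<bullet> t) = zer 0 E Y" using tri_cmp_zer[OF t] by (simp add: cat add_laws)
  qed (simp_all add: cat)
  have u: "tri (bp A B) ?u (bp Y B) ?v C (i1 A B \<bullet> e)"
    by (intro tri_transport[OF stabilize[OF i, of B], where a="idn (bp A B)" and a'="idn (bp A B)"
      and b="i1 Y B \<bullet> p1 Y B \<uplus> (i1 Y B \<bullet> g \<bullet> p2 Y B \<uplus> i2 Y B \<bullet> p2 Y B)"
      and b'="i1 Y B \<bullet> p1 Y B \<uplus> (neg (i1 Y B \<bullet> g \<bullet> p2 Y B) \<uplus> i2 Y B \<bullet> p2 Y B)"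
      and c="idn C" and c'="idn C"]) (simp_all add: cat add_laws bp_sum[symmetric])
  obtain h th F w q where h: "tri E (?u \<bullet> ?m) (bp Y B) h F th"
    "tri Y w F q C ((i \<bullet> p1 A B \<uplus> g \<bullet> p2 A B) \<bullet> (i1 A B \<bullet> e))"
    "w \<bullet> (i \<bullet> p1 A B \<uplus> g \<bullet> p2 A B) = h \<bullet> ?u" "?v = q \<bullet> h" "th \<bullet> w = d"
    "?m \<bullet> th = (i1 A B \<bullet> e) \<bullet> q"
    using et4[OF t u] by auto
  note [simp] = tri_typing[OF h(1)] tri_typing[OF h(2)]
  have um: "?u \<bullet> ?m = i2 Y B \<bullet> b" by (simp add: cat add_laws gb)
  have w: "tri Y w F q C (zer 1 C Y)" using h(2) by (simp add: cat cmp_ext_zer[OF i])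
  have hu: "(h \<bullet> ?u) \<bullet> x = (w \<bullet> (i \<bullet> p1 A B \<uplus> g \<bullet> p2 A B)) \<bullet> x" for x by (simp only: h(3))
  have hi1: "h \<bullet> (i1 Y B \<bullet> i) = w \<bullet> i" using hu[of "i1 A B"] by (simp add: cat)
  have hi2: "h \<bullet> (i1 Y B \<bullet> g) \<uplus> h \<bullet> i2 Y B = w \<bullet> g" using hu[of "i2 A B"] by (simp add: cat)
  have "(q \<bullet> h) \<bullet> x = ?v \<bullet> x" for x by (simp only: h(4))
  from this[of "i1 Y B"] this[of "i2 Y B"]
  have qh: "q \<bullet> (h \<bullet> i1 Y B) = p" "q \<bullet> (h \<bullet> i2 Y B) = neg (p \<bullet> g)" by (simp_all add: cat)
  obtain r0 where r0: "arr r0 F Y" "r0 \<bullet> w = idn Y"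
    using extend_left[OF w, of "idn Y" Y] by (auto simp: cat)
  note [simp] = r0(1)
  have "(r0 \<bullet> (h \<bullet> i1 Y B) \<uplus> neg (idn Y)) \<bullet> i = zer 0 A Y"
    by (simp add: cat hi1 reassoc[OF r0(2)] add_laws)
  then obtain c where c: "arr c C Y" "c \<bullet> p = r0 \<bullet> (h \<bullet> i1 Y B) \<uplus> neg (idn Y)"
    using extend_middle[OF i, of "r0 \<bullet> (h \<bullet> i1 Y B) \<uplus> neg (idn Y)" Y] by (auto simp: cat)
  note [simp] = c(1)
  \<comment> \<open>Correcting the retraction r0 of w by the map c that measures its failure on the
    summand Y makes it a retraction of h \<bullet> i1 Y B as well.\<close>
  define r where "r = r0 \<uplus> neg (c \<bullet> q)"
  have [simp]: "arr r F Y" by (simp add: r_def cat)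
  have rw: "r \<bullet> w = idn Y" by (simp add: r_def cat r0(2) tri_cmp_zer[OF w])
  have rh1: "r \<bullet> (h \<bullet> i1 Y B) = idn Y" by (simp add: r_def cat qh c(2) add_laws)
  have rh2: "r \<bullet> h \<bullet> i2 Y B = zer 0 B Y"
  proof -
    have "h \<bullet> i2 Y B = neg (h \<bullet> (i1 Y B \<bullet> g)) \<uplus> (h \<bullet> (i1 Y B \<bullet> g) \<uplus> h \<bullet> i2 Y B)"
      by (rule neg_add_cancel[symmetric]) (simp_all add: cat)
    also have "\<dots> = neg (h \<bullet> (i1 Y B \<bullet> g)) \<uplus> w \<bullet> g" by (simp only: hi2)
    finally have "r \<bullet> h \<bullet> i2 Y B = r \<bullet> (neg (h \<bullet> (i1 Y B \<bullet> g)) \<uplus> w \<bullet> g)" by (rule arg_cong)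
    also have "\<dots> = zer 0 B Y" by (simp add: cat reassoc[OF rw] reassoc3[OF rh1] neg_add_self)
    finally show ?thesis .
  qed
  have rh: "r \<bullet> h = p1 Y B"
    by (rule biproduct_eqI[of Y B]) (simp_all add: cat rh1 rh2)
  obtain v where v: "tri C v F r Y (zer 1 Y C)" "q \<bullet> v = idn C" "w \<bullet> r \<uplus> v \<bullet> q = idn F"
    using complement_of_retract[OF w _ rw] by auto
  note [simp] = tri_typing[OF v(1)]
  \<comment> \<open>The composite of h with the deflation r is the projection to Y, whose kernel is
    B.\<close>
  obtain f0 B0 g0 u0 e0 where z: "tri E f0 B0 g0 C (th \<bullet> v)" "tri B0 u0 (bp Y B) (p1 Y B) Y e0"
     "i2 Y B \<bullet> b = u0 \<bullet> f0" "v \<bullet> g0 = h \<bullet> u0"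
    using et4_op[OF h(1)[unfolded um] v(1)] unfolding rh by auto
  note [simp] = tri_typing[OF z(1)] tri_typing[OF z(2)]
  obtain j j' where j: "inverse_arrows j j' B0 B" "i2 Y B \<bullet> j = u0"
    using cocone_unique[OF z(2) split_tri'[of Y B]] by (metis ok_Obj ty(2,3))
  note [simp] = j(1)
  have "p2 Y B \<bullet> (i2 Y B \<bullet> b) = p2 Y B \<bullet> ((i2 Y B \<bullet> j) \<bullet> f0)" by (simp only: z(3) j(2))
  then have jf: "j \<bullet> f0 = b" by (simp add: cat)
  have "q \<bullet> (v \<bullet> g0) = q \<bullet> (h \<bullet> (i2 Y B \<bullet> j))" by (simp only: z(4) j(2))
  then have g0: "g0 = neg (p \<bullet> (g \<bullet> j))"
    by (simp add: reassoc[OF v(2)] cat reassoc3[OF qh(2)])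
  let ?r = "neg (th \<bullet> v)"
  have "tri E b B (p \<bullet> g) C ?r"
    by (intro tri_transport[OF z(1), where a="idn E" and a'="idn E" and b=j and b'=j'
      and c="neg (idn C)" and c'="neg (idn C)"]) (simp_all add: cat jf g0)
  moreover have "t \<bullet> ?r = e"
  proof -
    have "p1 A B \<bullet> (?m \<bullet> th) \<bullet> v = p1 A B \<bullet> ((i1 A B \<bullet> e) \<bullet> q) \<bullet> v" by (simp only: h(6))
    then show ?thesis by (simp add: cat v(2))
  qed
  moreover have "?r \<bullet> p = d"
  proof -
    have "h \<bullet> i1 Y B = (w \<bullet> r \<uplus> v \<bullet> q) \<bullet> (h \<bullet> i1 Y B)" by (simp only: v(3)) (simp add: cat)
    also have "\<dots> = w \<uplus> v \<bullet> p" by (simp add: cat rh1 qh)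
    finally have "th \<bullet> (h \<bullet> i1 Y B) = d \<uplus> th \<bullet> (v \<bullet> p)" by (simp add: cat h(5))
    moreover have "th \<bullet> (h \<bullet> i1 Y B) = zer 1 Y E"
      by (simp add: reassoc[OF tri_ext_cmp_zer[OF h(1)]] cat)
    ultimately have "d \<uplus> neg (neg (th \<bullet> (v \<bullet> p))) = zer 1 Y E" by (simp add: cat)
    then have "d = neg (th \<bullet> (v \<bullet> p))" by (rule sub_eq_zer) (simp_all add: cat)
    then show ?thesis by (simp add: cat)
  qed
  ultimately show thesis by (rule that)
qed

section \<open>The three by three diagram\<close>

definition tri_mor where
  "tri_mor X f Y g Z d X' f' Y' g' Z' d' a b c \<longleftrightarrow>
     tri X f Y g Z d \<and> tri X' f' Y' g' Z' d' \<and> arr a X X' \<and> arr b Y Y' \<and> arr c Z Z' \<and>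
     b \<bullet> f = f' \<bullet> a \<and> g' \<bullet> b = c \<bullet> g \<and> a \<bullet> d = d' \<bullet> c"

definition homotopic where
  "homotopic X f Y g Z d X' f' Y' g' Z' d' a b c \<longleftrightarrow> tri_mor X f Y g Z d X' f' Y' g' Z' d' a b c \<and>
    (\<exists>s E t r b1 b2. b = b2 \<bullet> b1 \<and>
       tri_mor X f Y g Z d X' s E t Z r a b1 (idn Z) \<and>
       tri_mor X' s E t Z r X' f' Y' g' Z' d' (idn X') b2 c \<and>
       tri X (i1 Y X' \<bullet> f \<uplus> i2 Y X' \<bullet> a) (bp Y X') (b1 \<bullet> p1 Y X' \<uplus> neg s \<bullet> p2 Y X') E (d \<bullet> t) \<and>
       tri E (i1 Z Y' \<bullet> neg t \<uplus> i2 Z Y' \<bullet> b2) (bp Z Y') (c \<bullet> p1 Z Y' \<uplus> g' \<bullet> p2 Z Y') Z' (s \<bullet> d'))"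

definition grid where
  "grid A1 fA A2 gA A3 dA B1 fB B2 gB B3 dB C1 fC C2 gC C3 dC j1 j2 j3 q1 q2 q3 e1 e2 e3 \<longleftrightarrow>
     tri_mor A1 fA A2 gA A3 dA B1 fB B2 gB B3 dB j1 j2 j3 \<and>
     tri_mor B1 fB B2 gB B3 dB C1 fC C2 gC C3 dC q1 q2 q3 \<and>
     tri_mor A1 j1 B1 q1 C1 e1 A2 j2 B2 q2 C2 e2 fA fB fC \<and>
     tri_mor A2 j2 B2 q2 C2 e2 A3 j3 B3 q3 C3 e3 gA gB gC"

text \<open>
  The column \<open>A2 \<rightarrow> B2 \<rightarrow> C2\<close> and the row \<open>C1 \<rightarrow> C2 \<rightarrow> C3\<close> come out of one application of (ET4) to
  \<open>b1\<close> and \<open>b2\<close>.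
\<close>

theorem homotopic_grid:
  assumes A: "tri A1 fA A2 gA A3 dA" and B: "tri B1 fB B2 gB B3 dB"
    and K1: "tri A1 j1 B1 q1 C1 e1" and K3: "tri A3 j3 B3 q3 C3 e3"
    and eq: "j1 \<bullet> dA = dB \<bullet> j3"
  obtains j2 fC C2 gC dC q2 e2 where
    "homotopic A1 fA A2 gA A3 dA B1 fB B2 gB B3 dB j1 j2 j3"
    "grid A1 fA A2 gA A3 dA B1 fB B2 gB B3 dB C1 fC C2 gC C3 dC j1 j2 j3 q1 q2 q3 e1 e2 e3"
proof -
  note [simp] = tri_typing[OF A] tri_typing[OF B] tri_typing[OF K1] tri_typing[OF K3]
  obtain s E t where E: "tri B1 s E t A3 (j1 \<bullet> dA)"
    using realize[of "j1 \<bullet> dA" A3 B1] by (auto simp: cat)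
  note [simp] = tri_typing[OF E]
  \<comment> \<open>The maps b1 and b2 use the same E but do not depend on each other.\<close>
  obtain b1 where b1: "arr b1 A2 E" "b1 \<bullet> fA = s \<bullet> j1" "t \<bullet> b1 = gA"
    "tri A1 (i1 A2 B1 \<bullet> fA \<uplus> i2 A2 B1 \<bullet> j1) (bp A2 B1) (b1 \<bullet> p1 A2 B1 \<uplus> neg s \<bullet> p2 A2 B1) E (dA \<bullet> t)"
    using pushout_square[OF A _ E] by auto
  obtain b2 where b2: "arr b2 E B2" "gB \<bullet> b2 = j3 \<bullet> t" "b2 \<bullet> s = fB"
    "tri E (i1 A3 B2 \<bullet> neg t \<uplus> i2 A3 B2 \<bullet> b2) (bp A3 B2) (j3 \<bullet> p1 A3 B2 \<uplus> gB \<bullet> p2 A3 B2) B3 (s \<bullet> dB)"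
    using pullback_square[OF B _ E[unfolded eq]] by auto
  note [simp] = b1(1) b2(1)
  obtain r where r: "tri A2 b1 E r C1 (fA \<bullet> e1)" "r \<bullet> s = q1"
    using inflation_of_pushout[OF A K1 E _ b1(4)] by auto
  obtain x where x: "tri E b2 B2 (q3 \<bullet> gB) C3 x" "t \<bullet> x = e3" "x \<bullet> q3 = s \<bullet> dB"
    using inflation_of_pullback[OF b2(4) K3] by auto
  note [simp] = tri_typing[OF r(1)] tri_typing[OF x(1)]
  obtain q2 e2 C2 fC gC where c: "tri A2 (b2 \<bullet> b1) B2 q2 C2 e2" "tri C1 fC C2 gC C3 (r \<bullet> x)"
    "fC \<bullet> r = q2 \<bullet> b2" "q3 \<bullet> gB = gC \<bullet> q2" "e2 \<bullet> fC = fA \<bullet> e1" "b1 \<bullet> e2 = x \<bullet> gC"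
    using et4[OF r(1) x(1)] by blast
  note [simp] = tri_typing[OF c(1)] tri_typing[OF c(2)]
  have j: "tri_mor A1 fA A2 gA A3 dA B1 fB B2 gB B3 dB j1 (b2 \<bullet> b1) j3"
    unfolding tri_mor_def using A B eq
    by (simp add: cat b1(2,3) reassoc[OF b2(2)] reassoc[OF b2(3)])
  have "tri_mor A1 fA A2 gA A3 dA B1 s E t A3 (j1 \<bullet> dA) j1 b1 (idn A3)"
    unfolding tri_mor_def using A E by (simp add: cat b1)
  moreover have "tri_mor B1 s E t A3 (j1 \<bullet> dA) B1 fB B2 gB B3 dB (idn B1) b2 j3"
    unfolding tri_mor_def using B E by (simp add: cat b2 eq)
  ultimately have "homotopic A1 fA A2 gA A3 dA B1 fB B2 gB B3 dB j1 (b2 \<bullet> b1) j3"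
    unfolding homotopic_def using j b1(4) b2(4) by blast
  moreover have "tri_mor B1 fB B2 gB B3 dB C1 fC C2 gC C3 (r \<bullet> x) q1 q2 q3"
  proof -
    have "q2 \<bullet> fB = fC \<bullet> q1"
      by (simp add: b2(3)[symmetric] r(2)[symmetric] reassoc[OF c(3)] cat)
    moreover have "q1 \<bullet> dB = (r \<bullet> x) \<bullet> q3"
      by (simp add: cat x(3) reassoc[OF r(2)])
    ultimately show ?thesis unfolding tri_mor_def using B c(2,4) by simp
  qed
  moreover have "tri_mor A1 j1 B1 q1 C1 e1 A2 (b2 \<bullet> b1) B2 q2 C2 e2 fA fB fC"
    using j calculation(2) K1 c(1,5) by (simp add: tri_mor_def)
  moreover have "tri_mor A2 (b2 \<bullet> b1) B2 q2 C2 e2 A3 j3 B3 q3 C3 e3 gA gB gC"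
  proof -
    have "gA \<bullet> e2 = e3 \<bullet> gC"
      by (simp add: b1(3)[symmetric] x(2)[symmetric] cat c(6))
    then show ?thesis unfolding tri_mor_def using j K3 c(1,4) by (simp add: tri_mor_def)
  qed
  ultimately have "homotopic A1 fA A2 gA A3 dA B1 fB B2 gB B3 dB j1 (b2 \<bullet> b1) j3"
    "grid A1 fA A2 gA A3 dA B1 fB B2 gB B3 dB C1 fC C2 gC C3 (r \<bullet> x) j1 (b2 \<bullet> b1) j3 q1 q2 q3 e1 e2 e3"
    using j unfolding grid_def by blast+
  then show thesis by (rule that)
qed

lemma tri_mor_middle_iso:
  assumes m: "tri_mor X f Y g Z d X' f' Y' g' Z' d' a b c" and h: "inverse_arrows h h' Y' Y''"
  shows "tri_mor X f Y g Z d X' (h \<bullet> f') Y'' (g' \<bullet> h') Z' d' a (h \<bullet> b) c"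
proof -
  have t: "tri X f Y g Z d" "tri X' f' Y' g' Z' d'" and ty: "arr a X X'" "arr b Y Y'" "arr c Z Z'"
    and eqs: "b \<bullet> f = f' \<bullet> a" "g' \<bullet> b = c \<bullet> g" "a \<bullet> d = d' \<bullet> c"
    using m unfolding tri_mor_def by blast+
  note [simp] = tri_typing[OF t(1)] tri_typing[OF t(2)] ty h
  have "(h \<bullet> b) \<bullet> f = (h \<bullet> f') \<bullet> a" "(g' \<bullet> h') \<bullet> (h \<bullet> b) = c \<bullet> g" "arr (h \<bullet> b) Y Y''"
    by (simp_all add: cat reassoc[of h' h] eqs(1,2))
  then show ?thesis
    unfolding tri_mor_def using t(1) realize_iso[OF t(2) h] ty(1,3) eqs(3) by blast
qed

lemma homotopic_middle_iso:
  assumes m: "homotopic X f Y g Z d X' f' Y' g' Z' d' a b c" and h: "inverse_arrows h h' Y' Y''"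
  shows "homotopic X f Y g Z d X' (h \<bullet> f') Y'' (g' \<bullet> h') Z' d' a (h \<bullet> b) c"
proof -
  obtain s E t r b1 b2 where s: "b = b2 \<bullet> b1"
      "tri_mor X f Y g Z d X' s E t Z r a b1 (idn Z)"
      "tri_mor X' s E t Z r X' f' Y' g' Z' d' (idn X') b2 c"
      "tri X (i1 Y X' \<bullet> f \<uplus> i2 Y X' \<bullet> a) (bp Y X') (b1 \<bullet> p1 Y X' \<uplus> neg s \<bullet> p2 Y X') E (d \<bullet> t)"
      "tri E (i1 Z Y' \<bullet> neg t \<uplus> i2 Z Y' \<bullet> b2) (bp Z Y') (c \<bullet> p1 Z Y' \<uplus> g' \<bullet> p2 Z Y') Z' (s \<bullet> d')"
      "tri_mor X f Y g Z d X' f' Y' g' Z' d' a b c"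
    using m unfolding homotopic_def by blast
  have t: "tri X' s E t Z r" "tri X' f' Y' g' Z' d'"
    and ty: "arr b2 E Y'" "arr b1 Y E" "arr c Z Z'"
    using s(2,3) unfolding tri_mor_def by blast+
  note [simp] = tri_typing[OF t(1)] tri_typing[OF t(2)] h ty
  have "tri E (i1 Z Y'' \<bullet> neg t \<uplus> i2 Z Y'' \<bullet> (h \<bullet> b2)) (bp Z Y'') (c \<bullet> p1 Z Y'' \<uplus> (g' \<bullet> h') \<bullet> p2 Z Y'') Z' (s \<bullet> d')"
    by (intro tri_transport[OF s(5), where a="idn E" and a'="idn E" and c="idn Z'" and c'="idn Z'"
      and b="i1 Z Y'' \<bullet> p1 Z Y' \<uplus> i2 Z Y'' \<bullet> h \<bullet> p2 Z Y'" and b'="i1 Z Y' \<bullet> p1 Z Y'' \<uplus> i2 Z Y' \<bullet> h' \<bullet> p2 Z Y''"])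
      (simp_all add: cat reassoc[of h' h] reassoc[of h h'] bp_sum)
  moreover have "h \<bullet> b = (h \<bullet> b2) \<bullet> b1" by (simp add: cat s(1))
  ultimately show ?thesis
    unfolding homotopic_def
    using s(2,4) tri_mor_middle_iso[OF s(6) h] tri_mor_middle_iso[OF s(3) h] by blast
qed

lemma grid_middle_iso:
  assumes m: "grid A1 fA A2 gA A3 dA B1 fB B2 gB B3 dB C1 fC C2 gC C3 dC j1 j2 j3 q1 q2 q3 e1 e2 e3"
    and h: "inverse_arrows h h' B2 B2'"
  shows "grid A1 fA A2 gA A3 dA B1 (h \<bullet> fB) B2' (gB \<bullet> h') B3 dB C1 fC C2 gC C3 dC
      j1 (h \<bullet> j2) j3 q1 (q2 \<bullet> h') q3 e1 e2 e3"
proof -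
  have g: "tri_mor A1 fA A2 gA A3 dA B1 fB B2 gB B3 dB j1 j2 j3"
     "tri_mor B1 fB B2 gB B3 dB C1 fC C2 gC C3 dC q1 q2 q3"
     "tri_mor A1 j1 B1 q1 C1 e1 A2 j2 B2 q2 C2 e2 fA fB fC"
     "tri_mor A2 j2 B2 q2 C2 e2 A3 j3 B3 q3 C3 e3 gA gB gC"
    using m unfolding grid_def by blast+
  have t: "tri A2 j2 B2 q2 C2 e2" "tri B1 fB B2 gB B3 dB"
    and q: "arr q1 B1 C1" "arr q2 B2 C2" "arr q3 B3 C3" "tri C1 fC C2 gC C3 dC"
      "q2 \<bullet> fB = fC \<bullet> q1" "gC \<bullet> q2 = q3 \<bullet> gB" "q1 \<bullet> dB = dC \<bullet> q3"
    and k: "arr gA A2 A3" "arr gB B2 B3" "arr gC C2 C3" "tri A3 j3 B3 q3 C3 e3"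
      "gB \<bullet> j2 = j3 \<bullet> gA" "q3 \<bullet> gB = gC \<bullet> q2" "gA \<bullet> e2 = e3 \<bullet> gC"
    using g unfolding tri_mor_def by blast+
  note [simp] = tri_typing[OF t(1)] tri_typing[OF t(2)] h q(1-3) k(1-3) tri_typing[OF k(4)]
  have "(q2 \<bullet> h') \<bullet> (h \<bullet> fB) = fC \<bullet> q1" "gC \<bullet> (q2 \<bullet> h') = q3 \<bullet> (gB \<bullet> h')"
       "(gB \<bullet> h') \<bullet> (h \<bullet> j2) = j3 \<bullet> gA" "arr (q2 \<bullet> h') B2' C2" "arr (gB \<bullet> h') B2' B3"
    by (simp_all add: cat reassoc[of h' h] reassoc[OF k(6)] q(5) k(5))
  then have "tri_mor B1 (h \<bullet> fB) B2' (gB \<bullet> h') B3 dB C1 fC C2 gC C3 dC q1 (q2 \<bullet> h') q3"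
    "tri_mor A2 (h \<bullet> j2) B2' (q2 \<bullet> h') C2 e2 A3 j3 B3 q3 C3 e3 gA (gB \<bullet> h') gC"
    unfolding tri_mor_def using realize_iso[OF t(1) h] realize_iso[OF t(2) h] q k by auto
  then show ?thesis
    unfolding grid_def using tri_mor_middle_iso[OF g(1) h] tri_mor_middle_iso[OF g(3) h] by blast
qed

end

section \<open>Morphisms and extensions as arrows of degree zero and one\<close>

text \<open>
  Source and target are recorded in the arrow, because the morphism groups of different pairs of
  objects may overlap.
\<close>

fun graded_ok :: "('o, 'm, 'e, 'x) ext_cat_scheme \<Rightarrow> 'o \<times> ('m + 'e) \<times> 'o \<Rightarrow> bool" where
  "graded_ok \<C> (X, Inl f, Y) \<longleftrightarrow> X \<in> Ob \<C> \<and> Y \<in> Ob \<C> \<and> f \<in> mors \<C> X Y"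
| "graded_ok \<C> (X, Inr \<delta>, Y) \<longleftrightarrow> X \<in> Ob \<C> \<and> Y \<in> Ob \<C> \<and> \<delta> \<in> exts \<C> X Y"

fun graded_deg :: "'o \<times> ('m + 'e) \<times> 'o \<Rightarrow> nat" where
  "graded_deg (X, Inl f, Y) = 0"
| "graded_deg (X, Inr \<delta>, Y) = 1"

text \<open>
  The last equation only makes composition total: two extensions are never composed.
\<close>

fun graded_cmp where
  "graded_cmp \<C> (_, Inl g, Z) (X, Inl f, _) = (X, Inl (g \<cdot>\<^bsub>\<C>\<^esub> f), Z)"
| "graded_cmp \<C> (_, Inl g, Z) (X, Inr \<delta>, _) = (X, Inr (push \<C> g \<delta>), Z)"
| "graded_cmp \<C> (_, Inr \<delta>, Z) (X, Inl f, _) = (X, Inr (pull \<C> f \<delta>), Z)"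
| "graded_cmp \<C> (_, Inr \<delta>, Z) (X, Inr _, _) = (X, Inr \<delta>, Z)"

fun graded_add where
  "graded_add \<C> (X, Inl f, Y) (_, Inl g, _) = (X, Inl (f \<oplus>\<^bsub>Hom \<C> X Y\<^esub> g), Y)"
| "graded_add \<C> (X, Inr \<delta>, Y) (_, Inr \<epsilon>, _) = (X, Inr (\<delta> \<oplus>\<^bsub>Ext \<C> X Y\<^esub> \<epsilon>), Y)"
| "graded_add \<C> a _ = a"

fun graded_neg where
  "graded_neg \<C> (X, Inl f, Y) = (X, Inl (\<ominus>\<^bsub>Hom \<C> X Y\<^esub> f), Y)"
| "graded_neg \<C> (X, Inr \<delta>, Y) = (X, Inr (\<ominus>\<^bsub>Ext \<C> X Y\<^esub> \<delta>), Y)"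

definition graded_zero where
  "graded_zero \<C> n X Y = (X, if n = 0 then Inl \<zero>\<^bsub>Hom \<C> X Y\<^esub> else Inr \<zero>\<^bsub>Ext \<C> X Y\<^esub>, Y)"

definition graded_tri where
  "graded_tri \<C> X F Y G Z D \<longleftrightarrow>
     (\<exists>f g \<delta>. F = (X, Inl f, Y) \<and> G = (Y, Inl g, Z) \<and> D = (Z, Inr \<delta>, X) \<and> is_etri \<C> (Tri X f Y g Z \<delta>))"

lemma graded_ok_iff:
  "graded_ok \<C> a \<longleftrightarrow> (\<exists>X Y. X \<in> Ob \<C> \<and> Y \<in> Ob \<C> \<and>
    ((\<exists>f. a = (X, Inl f, Y) \<and> f \<in> mors \<C> X Y) \<or> (\<exists>\<delta>. a = (X, Inr \<delta>, Y) \<and> \<delta> \<in> exts \<C> X Y)))"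
  by (cases "(\<C>, a)" rule: graded_ok.cases) auto

lemma graded_typing:
  "fst (graded_cmp \<C> a b) = fst b" "snd (snd (graded_cmp \<C> a b)) = snd (snd a)"
  "graded_deg a + graded_deg b \<le> 1 \<Longrightarrow> graded_deg (graded_cmp \<C> a b) = graded_deg a + graded_deg b"
  "fst (graded_add \<C> a b) = fst a" "snd (snd (graded_add \<C> a b)) = snd (snd a)"
  "graded_deg (graded_add \<C> a b) = graded_deg a"
  "fst (graded_neg \<C> a) = fst a" "snd (snd (graded_neg \<C> a)) = snd (snd a)"
  "graded_deg (graded_neg \<C> a) = graded_deg a"
  by (cases "(\<C>, a, b)" rule: graded_cmp.cases; simp)+

context additive_bifunctor
begin

lemmas Hom_group = Hom_abelian_group Ext_abelian_group
  abelian_group.axioms(1)[OF Hom_abelian_group] abelian_group.axioms(1)[OF Ext_abelian_group]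
lemmas group_laws = abelian_monoid.a_closed abelian_monoid.zero_closed abelian_group.a_inv_closed
  abelian_monoid.a_assoc abelian_monoid.a_comm abelian_monoid.l_zero abelian_monoid.r_zero
  abelian_monoid.a_lcomm abelian_group.r_neg

text \<open>
  This is where functoriality and biadditivity of the extension functor turn into associativity and
  distributivity.
\<close>

lemma graded_arrows_additive:
  "graded_arrows (Ob \<C>) (graded_ok \<C>) fst (\<lambda>a. snd (snd a)) graded_deg (graded_cmp \<C>) (graded_add \<C>)
     (graded_neg \<C>) (graded_zero \<C>) (\<lambda>X. (X, Inl (Idm \<C> X), X)) (Bip \<C>)
     (\<lambda>X Y. (X, Inl (in1 \<C> X Y), X \<boxplus> Y)) (\<lambda>X Y. (Y, Inl (in2 \<C> X Y), X \<boxplus> Y))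
     (\<lambda>X Y. (X \<boxplus> Y, Inl (pr1 \<C> X Y), X)) (\<lambda>X Y. (X \<boxplus> Y, Inl (pr2 \<C> X Y), Y))"
proof unfold_locales
  show "\<exists>N\<in>Ob \<C>. (N, Inl (Idm \<C> N), N) = graded_zero \<C> 0 N N"
    using zero_object_exists Idm_closed abelian_monoid.zero_closed[OF Hom_group(3)]
    by (fastforce simp: graded_zero_def zero_object_def)
qed (auto simp: graded_typing graded_ok_iff graded_zero_def Hom_group group_laws
   Idm_closed Cmp_closed Cmp_assoc Cmp_Idm Idm_Cmp
   Cmp_add_right Cmp_add_left push_closed pull_closed push_add pull_add push_Idm pull_Idm push_Cmp pull_Cmp
   push_pull push_add_mor pull_add_mor biproducts)

end

context additive_realization
begin

lemma realize_sequence: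
  assumes "Z \<in> Ob \<C>" "X \<in> Ob \<C>" "\<delta> \<in> exts \<C> Z X" "(Y, f, g) \<in> realize \<C> Z X \<delta>"
  shows "Y \<in> Ob \<C> \<and> f \<in> mors \<C> X Y \<and> g \<in> mors \<C> Y Z"
  using realize_class[OF assms(1-3)] assms(4) by (auto simp: quotient_def seq_equiv_def seqs_def)

lemma realize_nonempty:
  assumes "Z \<in> Ob \<C>" "X \<in> Ob \<C>" "\<delta> \<in> exts \<C> Z X"
  shows "\<exists>Y f g. (Y, f, g) \<in> realize \<C> Z X \<delta>"
proof -
  obtain Y f g where "(Y, f, g) \<in> seqs \<C> X Z" "realize \<C> Z X \<delta> = seq_equiv \<C> X Z `` {(Y, f, g)}"
    using realize_class[OF assms] by (auto elim!: quotientE)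
  moreover from this(1) have "iso_mor \<C> Y Y (Idm \<C> Y) \<and> Idm \<C> Y \<cdot> f = f \<and> g \<cdot> Idm \<C> Y = g"
    using assms by (auto simp: seqs_def iso_mor_def Idm_closed Idm_Cmp Cmp_Idm intro!: bexI[of _ "Idm \<C> Y"])
  ultimately have "(Y, f, g) \<in> realize \<C> Z X \<delta>" by (auto simp: seq_equiv_def)
  then show ?thesis by blast
qed

lemma realize_closed_iso:
  assumes ob: "Z \<in> Ob \<C>" "X \<in> Ob \<C>" "\<delta> \<in> exts \<C> Z X" and r: "(Y, f, g) \<in> realize \<C> Z X \<delta>"
    and h: "Y' \<in> Ob \<C>" "h \<in> mors \<C> Y Y'" "h' \<in> mors \<C> Y' Y" "h' \<cdot> h = Idm \<C> Y" "h \<cdot> h' = Idm \<C> Y'"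
  shows "(Y', h \<cdot> f, g \<cdot> h') \<in> realize \<C> Z X \<delta>"
proof -
  have Y: "Y \<in> Ob \<C>" "f \<in> mors \<C> X Y" "g \<in> mors \<C> Y Z" using realize_sequence[OF ob r] by auto
  obtain Y0 f0 g0 where S: "(Y0, f0, g0) \<in> seqs \<C> X Z"
    "realize \<C> Z X \<delta> = seq_equiv \<C> X Z `` {(Y0, f0, g0)}"
    using realize_class[OF ob] by (auto elim!: quotientE)
  then obtain k k' where k: "k \<in> mors \<C> Y0 Y" "k' \<in> mors \<C> Y Y0" "k' \<cdot> k = Idm \<C> Y0" "k \<cdot> k' = Idm \<C> Y"
    "k \<cdot> f0 = f" "g \<cdot> k = g0" and Y0: "Y0 \<in> Ob \<C>" "f0 \<in> mors \<C> X Y0" "g0 \<in> mors \<C> Y0 Z"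
    using r by (auto simp: seq_equiv_def seqs_def iso_mor_def)
  have inv: "(b' \<cdot> a') \<cdot> (a \<cdot> b) = Idm \<C> U"
    if "U \<in> Ob \<C>" "V \<in> Ob \<C>" "W \<in> Ob \<C>" "b \<in> mors \<C> U V" "a \<in> mors \<C> V W" "a' \<in> mors \<C> W V" "b' \<in> mors \<C> V U"
      "b' \<cdot> b = Idm \<C> U" "a' \<cdot> a = Idm \<C> V" for U V W a a' b b'
  proof -
    have "(b' \<cdot> a') \<cdot> (a \<cdot> b) = b' \<cdot> (a' \<cdot> (a \<cdot> b))"
      using that by (intro Cmp_assoc[of U W V U]) (auto intro: Cmp_closed)
    also have "a' \<cdot> (a \<cdot> b) = (a' \<cdot> a) \<cdot> b"
      using that by (intro Cmp_assoc[of U V W V, symmetric]) auto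
    finally show ?thesis using that by (simp add: Idm_Cmp)
  qed
  have "iso_mor \<C> Y0 Y' (h \<cdot> k)"
    unfolding iso_mor_def
    using inv[of Y0 Y Y' k h h' k'] inv[of Y' Y Y0 h' k' k h] h k Y Y0
    by (auto intro!: bexI[of _ "k' \<cdot> h'"] intro: Cmp_closed)
  moreover have "(h \<cdot> k) \<cdot> f0 = h \<cdot> f"
    using Cmp_assoc[of X Y0 Y Y' f0 k h] h k Y Y0 ob by simp
  moreover have "(g \<cdot> h') \<cdot> (h \<cdot> k) = g0"
  proof -
    have "(g \<cdot> h') \<cdot> (h \<cdot> k) = g \<cdot> (h' \<cdot> (h \<cdot> k))"
      using h k Y Y0 ob by (intro Cmp_assoc[of Y0 Y' Y Z]) (auto intro: Cmp_closed)
    also have "h' \<cdot> (h \<cdot> k) = (h' \<cdot> h) \<cdot> k"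
      using h k Y Y0 ob by (intro Cmp_assoc[of Y0 Y Y' Y, symmetric]) auto
    finally show ?thesis using h k Y Y0 by (simp add: Idm_Cmp)
  qed
  moreover have "(Y', h \<cdot> f, g \<cdot> h') \<in> seqs \<C> X Z"
    using h Y ob by (auto simp: seqs_def intro: Cmp_closed)
  ultimately show ?thesis using S by (auto simp: seq_equiv_def)
qed

end

context extriangulated_category
begin

lemma etri_typing:
  assumes "is_etri \<C> (Tri X f Y g Z \<delta>)"
  shows "X \<in> Ob \<C>" "Y \<in> Ob \<C>" "Z \<in> Ob \<C>" "f \<in> mors \<C> X Y" "g \<in> mors \<C> Y Z" "\<delta> \<in> exts \<C> Z X"
  using assms realize_sequence[of Z X \<delta> Y f g] by (simp_all add: is_etri_def)

abbreviation (input) graded_arr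
  where "graded_arr a X Y \<equiv> graded_ok \<C> a \<and> graded_deg a = 0 \<and> fst a = X \<and> snd (snd a) = Y \<and> X \<in> Ob \<C> \<and> Y \<in> Ob \<C>"

lemma graded_arrE:
  assumes "graded_arr a X Y"
  obtains f where "a = (X, Inl f, Y)" "f \<in> mors \<C> X Y"
  using assms unfolding graded_ok_iff by (metis fst_conv graded_deg.simps(2) snd_conv zero_neq_one)

lemma graded_triE:
  assumes "graded_tri \<C> X F Y G Z D"
  obtains f g \<delta> where "F = (X, Inl f, Y)" "G = (Y, Inl g, Z)" "D = (Z, Inr \<delta>, X)"
    "is_etri \<C> (Tri X f Y g Z \<delta>)"
  using assms unfolding graded_tri_def by blast

lemma graded_tri_iff:
  "graded_tri \<C> X (X1, Inl f, Y1) Y (Y2, Inl g, Z1) Z (Z2, Inr \<delta>, X2) \<longleftrightarrow>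
    X1 = X \<and> Y1 = Y \<and> Y2 = Y \<and> Z1 = Z \<and> Z2 = Z \<and> X2 = X \<and> is_etri \<C> (Tri X f Y g Z \<delta>)"
  by (auto simp: graded_tri_def)

lemma extri_arrows_graded:
  "extri_arrows (Ob \<C>) (graded_ok \<C>) fst (\<lambda>a. snd (snd a)) graded_deg (graded_cmp \<C>) (graded_add \<C>)
     (graded_neg \<C>) (graded_zero \<C>) (\<lambda>X. (X, Inl (Idm \<C> X), X)) (Bip \<C>)
     (\<lambda>X Y. (X, Inl (in1 \<C> X Y), X \<boxplus> Y)) (\<lambda>X Y. (Y, Inl (in2 \<C> X Y), X \<boxplus> Y))
     (\<lambda>X Y. (X \<boxplus> Y, Inl (pr1 \<C> X Y), X)) (\<lambda>X Y. (X \<boxplus> Y, Inl (pr2 \<C> X Y), Y))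
     (graded_tri \<C>)"
proof (intro extri_arrows.intro graded_arrows_additive extri_arrows_axioms.intro, goal_cases)
  case 1
  then show ?case by (auto simp: graded_tri_def is_etri_def dest: realize_sequence)
next
  case 2
  then show ?case
    by (auto simp: graded_tri_def is_etri_def graded_ok_iff dest: realize_nonempty)
next
  case 3
  then show ?case
    by (auto simp: graded_tri_def is_etri_def graded_ok_iff intro!: realize_closed_iso)
next
  case prems: (4 X F Y G Z D X' F' Y' G' Z' D' a c)
  obtain f g \<delta> where 1: "F = (X, Inl f, Y)" "G = (Y, Inl g, Z)" "D = (Z, Inr \<delta>, X)"
    "is_etri \<C> (Tri X f Y g Z \<delta>)" by (rule graded_triE[OF prems(1)])
  obtain f' g' \<delta>' where 2: "F' = (X', Inl f', Y')" "G' = (Y', Inl g', Z')" "D' = (Z', Inr \<delta>', X')"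
    "is_etri \<C> (Tri X' f' Y' g' Z' \<delta>')" by (rule graded_triE[OF prems(2)])
  obtain \<alpha> where 3: "a = (X, Inl \<alpha>, X')" "\<alpha> \<in> mors \<C> X X'" by (rule graded_arrE[OF prems(3)])
  obtain \<gamma> where 4: "c = (Z, Inl \<gamma>, Z')" "\<gamma> \<in> mors \<C> Z Z'" by (rule graded_arrE[OF prems(4)])
  have "\<exists>\<beta> \<in> mors \<C> Y Y'. \<beta> \<cdot> f = f' \<cdot> \<alpha> \<and> g' \<cdot> \<beta> = \<gamma> \<cdot> g"
    using prems(5) 1(4) 2(4) 3(2) 4(2) unfolding 1 2 3 4
    by (intro realize_mor[of Z X Z' X' \<delta> \<delta>' \<alpha> \<gamma>]) (simp_all add: is_etri_def)
  then obtain \<beta> where "\<beta> \<in> mors \<C> Y Y'" "\<beta> \<cdot> f = f' \<cdot> \<alpha>" "g' \<cdot> \<beta> = \<gamma> \<cdot> g" by blast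
  then show ?case unfolding 1 2 3 4
    by (intro exI[of _ "(Y, Inl \<beta>, Y')"]) (simp add: etri_typing[OF 1(4)] etri_typing[OF 2(4)])
next
  case 5 then show ?case
    using realize_zero abelian_monoid.zero_closed[OF Hom_group(4)]
    by (auto simp: graded_tri_def is_etri_def graded_zero_def)
next
  case prems: (6 X F Y G Z D X' F' Y' G' Z' D')
  obtain f g \<delta> where 1: "F = (X, Inl f, Y)" "G = (Y, Inl g, Z)" "D = (Z, Inr \<delta>, X)"
    "is_etri \<C> (Tri X f Y g Z \<delta>)" by (rule graded_triE[OF prems(1)])
  obtain f' g' \<delta>' where 2: "F' = (X', Inl f', Y')" "G' = (Y', Inl g', Z')" "D' = (Z', Inr \<delta>', X')"
    "is_etri \<C> (Tri X' f' Y' g' Z' \<delta>')" by (rule graded_triE[OF prems(2)])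
  note [simp] = etri_typing[OF 1(4)] etri_typing[OF 2(4)]
  have ext: "dsum_ext \<C> Z Z' X X' \<delta> \<delta>' \<in> exts \<C> (Z \<boxplus> Z') (X \<boxplus> X')"
    unfolding dsum_ext_def using biproducts[of X X'] biproducts[of Z Z']
    by (intro abelian_monoid.a_closed[OF Hom_group(4)] push_closed[of _ X] push_closed[of _ X'] 
      pull_closed[of Z] pull_closed[of Z']) auto
  have "is_etri \<C> (Tri (X \<boxplus> X') (dsum_mor \<C> X X' Y Y' f f') (Y \<boxplus> Y') (dsum_mor \<C> Y Y' Z Z' g g')
      (Z \<boxplus> Z') (dsum_ext \<C> Z Z' X X' \<delta> \<delta>'))"
    using realize_dsum[of Z X Z' X' \<delta> \<delta>' Y f g Y' f' g'] 1(4) 2(4) ext biproducts[of X X'] biproducts[of Z Z']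
    by (simp add: is_etri_def)
  then show ?case
    unfolding 1 2 by (simp add: graded_tri_iff dsum_mor_def col_mor_def dsum_ext_def)
next
  case prems: (7 X F Y G Z D X' F' Y' G' Z' D' a b)
  obtain f g \<delta> where 1: "F = (X, Inl f, Y)" "G = (Y, Inl g, Z)" "D = (Z, Inr \<delta>, X)"
    "is_etri \<C> (Tri X f Y g Z \<delta>)" by (rule graded_triE[OF prems(1)])
  obtain f' g' \<delta>' where 2: "F' = (X', Inl f', Y')" "G' = (Y', Inl g', Z')" "D' = (Z', Inr \<delta>', X')"
    "is_etri \<C> (Tri X' f' Y' g' Z' \<delta>')" by (rule graded_triE[OF prems(2)])
  obtain \<alpha> where 3: "a = (X, Inl \<alpha>, X')" "\<alpha> \<in> mors \<C> X X'" by (rule graded_arrE[OF prems(3)])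
  obtain \<beta> where 4: "b = (Y, Inl \<beta>, Y')" "\<beta> \<in> mors \<C> Y Y'" by (rule graded_arrE[OF prems(4)])
  obtain \<gamma> where "etri_mor \<C> (Tri X f Y g Z \<delta>) (Tri X' f' Y' g' Z' \<delta>') \<alpha> \<beta> \<gamma>"
    using ET3[OF 1(4) 2(4), of \<alpha> \<beta>] prems(5) 3(2) 4(2) unfolding 1 2 3 4 by auto
  then show ?case unfolding 1 2 3 4
    by (intro exI[of _ "(Z, Inl \<gamma>, Z')"]) (simp add: etri_mor_def etri_typing[OF 1(4)] etri_typing[OF 2(4)])
next
  case prems: (8 X F Y G Z D X' F' Y' G' Z' D' b c)
  obtain f g \<delta> where 1: "F = (X, Inl f, Y)" "G = (Y, Inl g, Z)" "D = (Z, Inr \<delta>, X)"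
    "is_etri \<C> (Tri X f Y g Z \<delta>)" by (rule graded_triE[OF prems(1)])
  obtain f' g' \<delta>' where 2: "F' = (X', Inl f', Y')" "G' = (Y', Inl g', Z')" "D' = (Z', Inr \<delta>', X')"
    "is_etri \<C> (Tri X' f' Y' g' Z' \<delta>')" by (rule graded_triE[OF prems(2)])
  obtain \<beta> where 3: "b = (Y, Inl \<beta>, Y')" "\<beta> \<in> mors \<C> Y Y'" by (rule graded_arrE[OF prems(3)])
  obtain \<gamma> where 4: "c = (Z, Inl \<gamma>, Z')" "\<gamma> \<in> mors \<C> Z Z'" by (rule graded_arrE[OF prems(4)])
  obtain \<alpha> where "etri_mor \<C> (Tri X f Y g Z \<delta>) (Tri X' f' Y' g' Z' \<delta>') \<alpha> \<beta> \<gamma>"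
    using ET3_op[OF 1(4) 2(4), of \<beta> \<gamma>] prems(5) 3(2) 4(2) unfolding 1 2 3 4 by auto
  then show ?case unfolding 1 2 3 4
    by (intro exI[of _ "(X, Inl \<alpha>, X')"]) (simp add: etri_mor_def etri_typing[OF 1(4)] etri_typing[OF 2(4)])
next
  case prems: (9 X F Y G Z D U V H W E)
  obtain f g \<delta> where 1: "F = (X, Inl f, Y)" "G = (Y, Inl g, Z)" "D = (Z, Inr \<delta>, X)"
    "is_etri \<C> (Tri X f Y g Z \<delta>)" by (rule graded_triE[OF prems(1)])
  obtain u v \<epsilon> where 2: "U = (Y, Inl u, V)" "H = (V, Inl v, W)" "E = (W, Inr \<epsilon>, Y)"
    "is_etri \<C> (Tri Y u V v W \<epsilon>)" by (rule graded_triE[OF prems(2)])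
  obtain h T \<theta> w q where "is_etri \<C> (Tri X (u \<cdot> f) V h T \<theta>)" "is_etri \<C> (Tri Z w T q W (push \<C> g \<epsilon>))"
    "w \<cdot> g = h \<cdot> u" "v = q \<cdot> h" "pull \<C> w \<theta> = \<delta>" "push \<C> f \<theta> = pull \<C> q \<epsilon>"
    using ET4[OF 1(4) 2(4)] by blast
  then show ?case unfolding 1 2
    by (intro exI[of _ "(V, Inl h, T)"] exI[of _ T] exI[of _ "(T, Inr \<theta>, X)"]
      exI[of _ "(Z, Inl w, T)"] exI[of _ "(T, Inl q, W)"]) (simp add: graded_tri_iff)
next
  case prems: (10 X M V H T Th Z W Q W' R)
  obtain m h \<theta> where 1: "M = (X, Inl m, V)" "H = (V, Inl h, T)" "Th = (T, Inr \<theta>, X)"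
    "is_etri \<C> (Tri X m V h T \<theta>)" by (rule graded_triE[OF prems(1)])
  obtain w q \<rho> where 2: "W = (Z, Inl w, T)" "Q = (T, Inl q, W')" "R = (W', Inr \<rho>, Z)"
    "is_etri \<C> (Tri Z w T q W' \<rho>)" by (rule graded_triE[OF prems(2)])
  obtain f Y g u \<epsilon> where "is_etri \<C> (Tri X f Y g Z (pull \<C> w \<theta>))" "is_etri \<C> (Tri Y u V (q \<cdot> h) W' \<epsilon>)"
    "m = u \<cdot> f" "w \<cdot> g = h \<cdot> u" "push \<C> g \<epsilon> = \<rho>" "push \<C> f \<theta> = pull \<C> q \<epsilon>"
    using ET4_op[OF 1(4) 2(4)] by blast
  then show ?case unfolding 1 2
    by (intro exI[of _ "(X, Inl f, Y)"] exI[of _ Y] exI[of _ "(Y, Inl g, Z)"]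
      exI[of _ "(Y, Inl u, V)"] exI[of _ "(W', Inr \<epsilon>, Y)"]) (simp add: graded_tri_iff)
qed

end

section \<open>Translation of the diagram\<close>

context extriangulated_category
begin

interpretation G: extri_arrows "Ob \<C>" "graded_ok \<C>" fst "\<lambda>a. snd (snd a)" graded_deg "graded_cmp \<C>"
  "graded_add \<C>" "graded_neg \<C>" "graded_zero \<C>" "\<lambda>X. (X, Inl (Idm \<C> X), X)" "Bip \<C>"
  "\<lambda>X Y. (X, Inl (in1 \<C> X Y), X \<boxplus> Y)" "\<lambda>X Y. (Y, Inl (in2 \<C> X Y), X \<boxplus> Y)"
  "\<lambda>X Y. (X \<boxplus> Y, Inl (pr1 \<C> X Y), X)" "\<lambda>X Y. (X \<boxplus> Y, Inl (pr2 \<C> X Y), Y)" "graded_tri \<C>"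
  by (rule extri_arrows_graded)

lemma tri_mor_graded_iff:
  "G.tri_mor X (X, Inl f, Y) Y (Y, Inl g, Z) Z (Z, Inr \<delta>, X)
     X' (X', Inl f', Y') Y' (Y', Inl g', Z') Z' (Z', Inr \<delta>', X')
     (X, Inl a, X') (Y, Inl b, Y') (Z, Inl c, Z') \<longleftrightarrow>
   etri_mor \<C> (Tri X f Y g Z \<delta>) (Tri X' f' Y' g' Z' \<delta>') a b c"
  using etri_typing[of X f Y g Z \<delta>] etri_typing[of X' f' Y' g' Z' \<delta>']
  by (auto simp: G.tri_mor_def etri_mor_def graded_tri_iff)

lemma homotopic_mor_graded:
  assumes "G.homotopic X (X, Inl f, Y) Y (Y, Inl g, Z) Z (Z, Inr \<delta>, X)
     X' (X', Inl f', Y') Y' (Y', Inl g', Z') Z' (Z', Inr \<delta>', X')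
     (X, Inl a, X') (Y, Inl b, Y') (Z, Inl c, Z')"
  shows "homotopic_mor \<C> (Tri X f Y g Z \<delta>) (Tri X' f' Y' g' Z' \<delta>') a b c"
proof -
  obtain S E T R B1 B2 where B: "(Y, Inl b, Y') = graded_cmp \<C> B2 B1"
    and m1: "G.tri_mor X (X, Inl f, Y) Y (Y, Inl g, Z) Z (Z, Inr \<delta>, X) X' S E T Z R
      (X, Inl a, X') B1 (Z, Inl (Idm \<C> Z), Z)"
    and m2: "G.tri_mor X' S E T Z R X' (X', Inl f', Y') Y' (Y', Inl g', Z') Z' (Z', Inr \<delta>', X')
      (X', Inl (Idm \<C> X'), X') B2 (Z, Inl c, Z')"
    and t1: "graded_tri \<C> X (graded_add \<C> (graded_cmp \<C> (Y, Inl (in1 \<C> Y X'), Y \<boxplus> X') (X, Inl f, Y))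
        (graded_cmp \<C> (X', Inl (in2 \<C> Y X'), Y \<boxplus> X') (X, Inl a, X'))) (Y \<boxplus> X')
      (graded_add \<C> (graded_cmp \<C> B1 (Y \<boxplus> X', Inl (pr1 \<C> Y X'), Y))
        (graded_cmp \<C> (graded_neg \<C> S) (Y \<boxplus> X', Inl (pr2 \<C> Y X'), X'))) E (graded_cmp \<C> (Z, Inr \<delta>, X) T)"
    and t2: "graded_tri \<C> E (graded_add \<C> (graded_cmp \<C> (Z, Inl (in1 \<C> Z Y'), Z \<boxplus> Y') (graded_neg \<C> T))
        (graded_cmp \<C> (Y', Inl (in2 \<C> Z Y'), Z \<boxplus> Y') B2)) (Z \<boxplus> Y')
      (graded_add \<C> (graded_cmp \<C> (Z, Inl c, Z') (Z \<boxplus> Y', Inl (pr1 \<C> Z Y'), Z))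
        (graded_cmp \<C> (Y', Inl g', Z') (Z \<boxplus> Y', Inl (pr2 \<C> Z Y'), Y'))) Z' (graded_cmp \<C> S (Z', Inr \<delta>', X'))"
    and m: "G.tri_mor X (X, Inl f, Y) Y (Y, Inl g, Z) Z (Z, Inr \<delta>, X)
     X' (X', Inl f', Y') Y' (Y', Inl g', Z') Z' (Z', Inr \<delta>', X')
     (X, Inl a, X') (Y, Inl b, Y') (Z, Inl c, Z')"
    using assms unfolding G.homotopic_def by blast
  have "graded_tri \<C> X' S E T Z R" using m1 unfolding G.tri_mor_def by blast
  then obtain s t \<eta> where S: "S = (X', Inl s, E)" "T = (E, Inl t, Z)" "R = (Z, Inr \<eta>, X')"
    and E: "is_etri \<C> (Tri X' s E t Z \<eta>)" by (rule graded_triE)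
  obtain b1 where b1: "B1 = (Y, Inl b1, E)" "b1 \<in> mors \<C> Y E"
    by (rule graded_arrE[of B1 Y E]) (use m1 in \<open>unfold G.tri_mor_def, blast\<close>)
  obtain b2 where b2: "B2 = (E, Inl b2, Y')" "b2 \<in> mors \<C> E Y'"
    by (rule graded_arrE[of B2 E Y']) (use m2 in \<open>unfold G.tri_mor_def, blast\<close>)
  show ?thesis
    unfolding homotopic_mor_def tri.sel
    using m m1 m2 t1 t2 B b1(2) b2(2) E
    unfolding S b1(1) b2(1) tri_mor_graded_iff
    by (intro conjI exI[of _ s] exI[of _ E] exI[of _ t] exI[of _ \<eta>] exI[of _ b1] exI[of _ b2])
      (simp_all add: graded_tri_iff col_mor_def row_mor_def)
qed

lemma diagram_graded:
  assumes "G.grid A1 (A1, Inl fA, A2) A2 (A2, Inl gA, A3) A3 (A3, Inr \<delta>A, A1)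
      B1 (B1, Inl fB, B2) B2 (B2, Inl gB, B3) B3 (B3, Inr \<delta>B, B1)
      C1 (C1, Inl fC, C2) C2 (C2, Inl gC, C3) C3 (C3, Inr \<delta>C, C1)
      (A1, Inl j1, B1) (A2, Inl j2, B2) (A3, Inl j3, B3) (B1, Inl q1, C1) (B2, Inl q2, C2) (B3, Inl q3, C3)
      (C1, Inr \<epsilon>1, A1) (C2, Inr \<epsilon>2, A2) (C3, Inr \<epsilon>3, A3)"
  shows "diagram_3x3 \<C> (Tri A1 fA A2 gA A3 \<delta>A) (Tri B1 fB B2 gB B3 \<delta>B) (Tri C1 fC C2 gC C3 \<delta>C)
      (Tri A1 j1 B1 q1 C1 \<epsilon>1) (Tri A2 j2 B2 q2 C2 \<epsilon>2) (Tri A3 j3 B3 q3 C3 \<epsilon>3)"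
proof -
  have "is_etri \<C> T \<and> is_etri \<C> T'" if "etri_mor \<C> T T' a b c" for T T' a b c
    using that by (simp add: etri_mor_def)
  then show ?thesis
    using assms unfolding G.grid_def tri_mor_graded_iff diagram_3x3_def tri.sel by blast
qed

text \<open>
  The last conclusion transports the diagram to any other realization of \<open>\<delta>B\<close>; it is needed
  together with the diagram itself because both share the third row and the outer columns.
\<close>

lemma homotopic_3x3:
  assumes A: "is_etri \<C> (Tri A1 fA A2 gA A3 \<delta>A)" and B: "is_etri \<C> (Tri B1 fB B2 gB B3 \<delta>B)"
    and K1: "is_etri \<C> (Tri A1 j1 B1 q1 C1 \<epsilon>1)" and K3: "is_etri \<C> (Tri A3 j3 B3 q3 C3 \<epsilon>3)"
    and eq: "push \<C> j1 \<delta>A = pull \<C> j3 \<delta>B"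
  obtains j2 fC C2 gC \<delta>C q2 \<epsilon>2 where "is_etri \<C> (Tri A2 j2 B2 q2 C2 \<epsilon>2)"
    "homotopic_mor \<C> (Tri A1 fA A2 gA A3 \<delta>A) (Tri B1 fB B2 gB B3 \<delta>B) j1 j2 j3"
    "diagram_3x3 \<C> (Tri A1 fA A2 gA A3 \<delta>A) (Tri B1 fB B2 gB B3 \<delta>B) (Tri C1 fC C2 gC C3 \<delta>C)
      (Tri A1 j1 B1 q1 C1 \<epsilon>1) (Tri A2 j2 B2 q2 C2 \<epsilon>2) (Tri A3 j3 B3 q3 C3 \<epsilon>3)"
    "\<And>B2' fB' gB'. is_etri \<C> (Tri B1 fB' B2' gB' B3 \<delta>B) \<Longrightarrow>
      \<exists>\<phi> q2'. iso_mor \<C> B2 B2' \<phi> \<and> \<phi> \<cdot> fB = fB' \<and> gB' \<cdot> \<phi> = gB \<and> q2' \<cdot> \<phi> = q2 \<and>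
       is_etri \<C> (Tri A2 (\<phi> \<cdot> j2) B2' q2' C2 \<epsilon>2) \<and>
       homotopic_mor \<C> (Tri A1 fA A2 gA A3 \<delta>A) (Tri B1 fB' B2' gB' B3 \<delta>B) j1 (\<phi> \<cdot> j2) j3 \<and>
       diagram_3x3 \<C> (Tri A1 fA A2 gA A3 \<delta>A) (Tri B1 fB' B2' gB' B3 \<delta>B) (Tri C1 fC C2 gC C3 \<delta>C)
        (Tri A1 j1 B1 q1 C1 \<epsilon>1) (Tri A2 (\<phi> \<cdot> j2) B2' q2' C2 \<epsilon>2) (Tri A3 j3 B3 q3 C3 \<epsilon>3)"
proof -
  have gA: "graded_tri \<C> A1 (A1, Inl fA, A2) A2 (A2, Inl gA, A3) A3 (A3, Inr \<delta>A, A1)"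
    and gB: "graded_tri \<C> B1 (B1, Inl fB, B2) B2 (B2, Inl gB, B3) B3 (B3, Inr \<delta>B, B1)"
    and g1: "graded_tri \<C> A1 (A1, Inl j1, B1) B1 (B1, Inl q1, C1) C1 (C1, Inr \<epsilon>1, A1)"
    and g3: "graded_tri \<C> A3 (A3, Inl j3, B3) B3 (B3, Inl q3, C3) C3 (C3, Inr \<epsilon>3, A3)"
    using A B K1 K3 by (simp_all add: graded_tri_iff)
  have "graded_cmp \<C> (A1, Inl j1, B1) (A3, Inr \<delta>A, A1) = graded_cmp \<C> (B3, Inr \<delta>B, B1) (A3, Inl j3, B3)"
    using eq by simp
  then obtain J2 FC C2 GC DC Q2 E2 where
    h: "G.homotopic A1 (A1, Inl fA, A2) A2 (A2, Inl gA, A3) A3 (A3, Inr \<delta>A, A1)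
      B1 (B1, Inl fB, B2) B2 (B2, Inl gB, B3) B3 (B3, Inr \<delta>B, B1) (A1, Inl j1, B1) J2 (A3, Inl j3, B3)"
    and d: "G.grid A1 (A1, Inl fA, A2) A2 (A2, Inl gA, A3) A3 (A3, Inr \<delta>A, A1)
      B1 (B1, Inl fB, B2) B2 (B2, Inl gB, B3) B3 (B3, Inr \<delta>B, B1)
      C1 FC C2 GC C3 DC (A1, Inl j1, B1) J2 (A3, Inl j3, B3) (B1, Inl q1, C1) Q2 (B3, Inl q3, C3)
      (C1, Inr \<epsilon>1, A1) E2 (C3, Inr \<epsilon>3, A3)"
    by (rule G.homotopic_grid[OF gA gB g1 g3])
  have K2: "graded_tri \<C> A2 J2 B2 Q2 C2 E2" and RC: "graded_tri \<C> C1 FC C2 GC C3 DC"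
    using d unfolding G.grid_def G.tri_mor_def by blast+
  obtain j2 q2 \<epsilon>2 where k2: "J2 = (A2, Inl j2, B2)" "Q2 = (B2, Inl q2, C2)" "E2 = (C2, Inr \<epsilon>2, A2)"
     "is_etri \<C> (Tri A2 j2 B2 q2 C2 \<epsilon>2)" by (rule graded_triE[OF K2])
  obtain fC gC \<delta>C where rc: "FC = (C1, Inl fC, C2)" "GC = (C2, Inl gC, C3)" "DC = (C3, Inr \<delta>C, C1)"
    by (rule graded_triE[OF RC])
  note h = h[unfolded k2(1-3)] and d = d[unfolded k2(1-3) rc]
  have "\<exists>\<phi> q2'. iso_mor \<C> B2 B2' \<phi> \<and> \<phi> \<cdot> fB = fB' \<and> gB' \<cdot> \<phi> = gB \<and> q2' \<cdot> \<phi> = q2 \<and>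
       is_etri \<C> (Tri A2 (\<phi> \<cdot> j2) B2' q2' C2 \<epsilon>2) \<and>
       homotopic_mor \<C> (Tri A1 fA A2 gA A3 \<delta>A) (Tri B1 fB' B2' gB' B3 \<delta>B) j1 (\<phi> \<cdot> j2) j3 \<and>
       diagram_3x3 \<C> (Tri A1 fA A2 gA A3 \<delta>A) (Tri B1 fB' B2' gB' B3 \<delta>B) (Tri C1 fC C2 gC C3 \<delta>C)
        (Tri A1 j1 B1 q1 C1 \<epsilon>1) (Tri A2 (\<phi> \<cdot> j2) B2' q2' C2 \<epsilon>2) (Tri A3 j3 B3 q3 C3 \<epsilon>3)"
    if B': "is_etri \<C> (Tri B1 fB' B2' gB' B3 \<delta>B)" for B2' fB' gB'
  proof -
    have "graded_tri \<C> B1 (B1, Inl fB', B2') B2' (B2', Inl gB', B3) B3 (B3, Inr \<delta>B, B1)"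
      using B' by (simp add: graded_tri_iff)
    from gB this obtain H H' where H: "G.inverse_arrows H H' B2 B2'" "graded_cmp \<C> H (B1, Inl fB, B2) = (B1, Inl fB', B2')"
      "graded_cmp \<C> (B2', Inl gB', B3) H = (B2, Inl gB, B3)" "graded_cmp \<C> (B2, Inl gB, B3) H' = (B2', Inl gB', B3)"
      by (rule G.realization_unique)
    obtain \<phi> where \<phi>: "H = (B2, Inl \<phi>, B2')" "\<phi> \<in> mors \<C> B2 B2'"
      by (rule graded_arrE[of H B2 B2']) (use H(1) in blast)
    obtain \<psi> where \<psi>: "H' = (B2', Inl \<psi>, B2)" "\<psi> \<in> mors \<C> B2' B2"
      by (rule graded_arrE[of H' B2' B2]) (use H(1) in blast)
    note t = etri_typing[OF k2(4)] etri_typing[OF B']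
    have inv: "\<psi> \<cdot> \<phi> = Idm \<C> B2" "\<phi> \<cdot> \<psi> = Idm \<C> B2'" using H(1) \<phi> \<psi> by auto
    have h': "homotopic_mor \<C> (Tri A1 fA A2 gA A3 \<delta>A) (Tri B1 fB' B2' gB' B3 \<delta>B) j1 (\<phi> \<cdot> j2) j3"
      using G.homotopic_middle_iso[OF h H(1)] unfolding H(2,4)
      by (intro homotopic_mor_graded) (simp add: \<phi>)
    have d': "diagram_3x3 \<C> (Tri A1 fA A2 gA A3 \<delta>A) (Tri B1 fB' B2' gB' B3 \<delta>B) (Tri C1 fC C2 gC C3 \<delta>C)
        (Tri A1 j1 B1 q1 C1 \<epsilon>1) (Tri A2 (\<phi> \<cdot> j2) B2' (q2 \<cdot> \<psi>) C2 \<epsilon>2) (Tri A3 j3 B3 q3 C3 \<epsilon>3)"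
      using G.grid_middle_iso[OF d H(1)] unfolding H(2,4)
      by (intro diagram_graded) (simp add: \<phi> \<psi>)
    moreover have "(q2 \<cdot> \<psi>) \<cdot> \<phi> = q2"
      using Cmp_assoc[of B2 B2' B2 C2 \<phi> \<psi> q2] t \<phi>(2) \<psi>(2) inv by (simp add: Cmp_Idm)
    moreover have "iso_mor \<C> B2 B2' \<phi>" unfolding iso_mor_def using \<phi>(2) \<psi>(2) inv by blast
    moreover have "\<phi> \<cdot> fB = fB'" "gB' \<cdot> \<phi> = gB" using H(2,3) \<phi> by simp_all
    moreover have "is_etri \<C> (Tri A2 (\<phi> \<cdot> j2) B2' (q2 \<cdot> \<psi>) C2 \<epsilon>2)"
      using d' unfolding diagram_3x3_def by blast
    ultimately show ?thesis using h' by blast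
  qed
  then show thesis
    by (rule that[OF k2(4) homotopic_mor_graded[OF h] diagram_graded[OF d]])
qed

text \<open>
  Both sides vanish, the left one because \<open>f\<^sub>*\<delta> = 0\<close> by exactness.
\<close>

lemma push_factor_zero:
  assumes A: "is_etri \<C> (Tri X f Y g Z \<delta>)" and k: "k \<in> mors \<C> Y V" "V \<in> Ob \<C>"
    and j: "j \<in> mors \<C> Z W" "W \<in> Ob \<C>"
  shows "push \<C> (k \<cdot> f) \<delta> = pull \<C> j \<zero>\<^bsub>Ext \<C> W V\<^esub>"
proof -
  note t = etri_typing[OF A]
  have "push \<C> f \<delta> = \<zero>\<^bsub>Ext \<C> Z Y\<^esub>"
    using G.cmp_ext_zer[of X "(X, Inl f, Y)" Y "(Y, Inl g, Z)" Z "(Z, Inr \<delta>, X)"] A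
    by (simp add: graded_tri_iff graded_zero_def)
  moreover have "push \<C> k \<zero>\<^bsub>Ext \<C> Z Y\<^esub> = \<zero>\<^bsub>Ext \<C> Z V\<^esub>"
    using G.cmp_zer[of "(Y, Inl k, V)" Y Z 1] k t by (simp add: graded_zero_def)
  moreover have "pull \<C> j \<zero>\<^bsub>Ext \<C> W V\<^esub> = \<zero>\<^bsub>Ext \<C> Z V\<^esub>"
    using G.zer_cmp[of "(Z, Inl j, W)" W V 1] k j t by (simp add: graded_zero_def)
  ultimately show ?thesis using push_Cmp[of Z X Y V f k \<delta>] k t by simp
qed

end

theorem theorem1p4:
  fixes \<C> :: "('o, 'm, 'e, 'x) ext_cat_scheme"
  assumes "extriangulated_category \<C>"
    and "is_etri \<C> (Tri A1 fA A2 gA A3 \<delta>A)"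
    and "is_etri \<C> (Tri B1 fB B2 gB B3 \<delta>B)"
    and "inflation \<C> A1 B1 i1"
    and "inflation \<C> A3 B3 i3"
  shows "(push \<C> i1 \<delta>A = pull \<C> i3 \<delta>B \<longrightarrow>
      (\<exists>i2 fC gC \<delta>C p1 p2 p3 \<epsilon>1 \<epsilon>2 \<epsilon>3 C1 C2 C3.
        inflation \<C> A2 B2 i2 \<and>
        homotopic_mor \<C> (Tri A1 fA A2 gA A3 \<delta>A) (Tri B1 fB B2 gB B3 \<delta>B) i1 i2 i3 \<and>
        diagram_3x3 \<C>
          (Tri A1 fA A2 gA A3 \<delta>A) (Tri B1 fB B2 gB B3 \<delta>B) (Tri C1 fC C2 gC C3 \<delta>C)
          (Tri A1 i1 B1 p1 C1 \<epsilon>1) (Tri A2 i2 B2 p2 C2 \<epsilon>2) (Tri A3 i3 B3 p3 C3 \<epsilon>3)))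
    \<and> ((\<exists>k \<in> mors \<C> A2 B1. i1 = k \<cdot>\<^bsub>\<C>\<^esub> fA) \<and> \<delta>B = \<zero>\<^bsub>Ext \<C> B3 B1\<^esub> \<longrightarrow>
      (\<exists>i2 p2 \<phi> i2' p2' fC gC \<delta>C p1 p3 \<epsilon>1 \<epsilon>2 \<epsilon>3 C1 C2 C3.
        inflation \<C> A2 B2 i2 \<and>
        homotopic_mor \<C> (Tri A1 fA A2 gA A3 \<delta>A) (Tri B1 fB B2 gB B3 \<delta>B) i1 i2 i3 \<and>
        diagram_3x3 \<C>
          (Tri A1 fA A2 gA A3 \<delta>A) (Tri B1 fB B2 gB B3 \<delta>B) (Tri C1 fC C2 gC C3 \<delta>C)
          (Tri A1 i1 B1 p1 C1 \<epsilon>1) (Tri A2 i2 B2 p2 C2 \<epsilon>2) (Tri A3 i3 B3 p3 C3 \<epsilon>3) \<and>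
        iso_mor \<C> B2 (B1 \<boxplus>\<^bsub>\<C>\<^esub> B3) \<phi> \<and> \<phi> \<cdot>\<^bsub>\<C>\<^esub> fB = in1 \<C> B1 B3 \<and> pr2 \<C> B1 B3 \<cdot>\<^bsub>\<C>\<^esub> \<phi> = gB \<and>
        i2' = \<phi> \<cdot>\<^bsub>\<C>\<^esub> i2 \<and> p2' \<cdot>\<^bsub>\<C>\<^esub> \<phi> = p2 \<and>
        inflation \<C> A2 (B1 \<boxplus>\<^bsub>\<C>\<^esub> B3) i2' \<and>
        homotopic_mor \<C> (Tri A1 fA A2 gA A3 \<delta>A)
          (Tri B1 (in1 \<C> B1 B3) (B1 \<boxplus>\<^bsub>\<C>\<^esub> B3) (pr2 \<C> B1 B3) B3 \<zero>\<^bsub>Ext \<C> B3 B1\<^esub>) i1 i2' i3 \<and>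
        diagram_3x3 \<C>
          (Tri A1 fA A2 gA A3 \<delta>A)
          (Tri B1 (in1 \<C> B1 B3) (B1 \<boxplus>\<^bsub>\<C>\<^esub> B3) (pr2 \<C> B1 B3) B3 \<zero>\<^bsub>Ext \<C> B3 B1\<^esub>)
          (Tri C1 fC C2 gC C3 \<delta>C)
          (Tri A1 i1 B1 p1 C1 \<epsilon>1)
          (Tri A2 i2' (B1 \<boxplus>\<^bsub>\<C>\<^esub> B3) p2' C2 \<epsilon>2)
          (Tri A3 i3 B3 p3 C3 \<epsilon>3)))"
proof -
  interpret extriangulated_category \<C> by fact
  obtain p1 C1 \<epsilon>1 where K1: "is_etri \<C> (Tri A1 i1 B1 p1 C1 \<epsilon>1)"
    using assms(4) unfolding inflation_def by blast
  obtain p3 C3 \<epsilon>3 where K3: "is_etri \<C> (Tri A3 i3 B3 p3 C3 \<epsilon>3)"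
    using assms(5) unfolding inflation_def by blast
  note t = etri_typing[OF assms(2)] etri_typing[OF assms(3)] etri_typing[OF K1] etri_typing[OF K3]
  show ?thesis (is "(_ \<longrightarrow> ?P) \<and> (_ \<longrightarrow> ?Q)")
  proof (intro conjI impI)
    assume "push \<C> i1 \<delta>A = pull \<C> i3 \<delta>B"
    then obtain i2 fC C2 gC \<delta>C p2 \<epsilon>2 where 1: "is_etri \<C> (Tri A2 i2 B2 p2 C2 \<epsilon>2)"
      "homotopic_mor \<C> (Tri A1 fA A2 gA A3 \<delta>A) (Tri B1 fB B2 gB B3 \<delta>B) i1 i2 i3"
      "diagram_3x3 \<C> (Tri A1 fA A2 gA A3 \<delta>A) (Tri B1 fB B2 gB B3 \<delta>B) (Tri C1 fC C2 gC C3 \<delta>C)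
        (Tri A1 i1 B1 p1 C1 \<epsilon>1) (Tri A2 i2 B2 p2 C2 \<epsilon>2) (Tri A3 i3 B3 p3 C3 \<epsilon>3)"
      by (rule homotopic_3x3[OF assms(2,3) K1 K3])
    from 1(1) have "inflation \<C> A2 B2 i2" unfolding inflation_def by blast
    with 1(2,3) show ?P by blast
  next
    assume *: "(\<exists>k \<in> mors \<C> A2 B1. i1 = k \<cdot>\<^bsub>\<C>\<^esub> fA) \<and> \<delta>B = \<zero>\<^bsub>Ext \<C> B3 B1\<^esub>"
    then have "push \<C> i1 \<delta>A = pull \<C> i3 \<delta>B"
      using push_factor_zero[OF assms(2), of _ B1 i3 B3] t by blast
    then obtain i2 fC C2 gC \<delta>C p2 \<epsilon>2 where 1: "is_etri \<C> (Tri A2 i2 B2 p2 C2 \<epsilon>2)"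
      "homotopic_mor \<C> (Tri A1 fA A2 gA A3 \<delta>A) (Tri B1 fB B2 gB B3 \<delta>B) i1 i2 i3"
      "diagram_3x3 \<C> (Tri A1 fA A2 gA A3 \<delta>A) (Tri B1 fB B2 gB B3 \<delta>B) (Tri C1 fC C2 gC C3 \<delta>C)
        (Tri A1 i1 B1 p1 C1 \<epsilon>1) (Tri A2 i2 B2 p2 C2 \<epsilon>2) (Tri A3 i3 B3 p3 C3 \<epsilon>3)"
    and 2: "\<And>B2' fB' gB'. is_etri \<C> (Tri B1 fB' B2' gB' B3 \<delta>B) \<Longrightarrow>
      \<exists>\<phi> q2'. iso_mor \<C> B2 B2' \<phi> \<and> \<phi> \<cdot>\<^bsub>\<C>\<^esub> fB = fB' \<and> gB' \<cdot>\<^bsub>\<C>\<^esub> \<phi> = gB \<and> q2' \<cdot>\<^bsub>\<C>\<^esub> \<phi> = p2 \<and>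
       is_etri \<C> (Tri A2 (\<phi> \<cdot>\<^bsub>\<C>\<^esub> i2) B2' q2' C2 \<epsilon>2) \<and>
       homotopic_mor \<C> (Tri A1 fA A2 gA A3 \<delta>A) (Tri B1 fB' B2' gB' B3 \<delta>B) i1 (\<phi> \<cdot>\<^bsub>\<C>\<^esub> i2) i3 \<and>
       diagram_3x3 \<C> (Tri A1 fA A2 gA A3 \<delta>A) (Tri B1 fB' B2' gB' B3 \<delta>B) (Tri C1 fC C2 gC C3 \<delta>C)
        (Tri A1 i1 B1 p1 C1 \<epsilon>1) (Tri A2 (\<phi> \<cdot>\<^bsub>\<C>\<^esub> i2) B2' q2' C2 \<epsilon>2) (Tri A3 i3 B3 p3 C3 \<epsilon>3)"
      by (rule homotopic_3x3[OF assms(2,3) K1 K3]) (rule that)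
    have "is_etri \<C> (Tri B1 (in1 \<C> B1 B3) (B1 \<boxplus>\<^bsub>\<C>\<^esub> B3) (pr2 \<C> B1 B3) B3 \<delta>B)"
      using realize_zero[of B3 B1] t * by (simp add: is_etri_def)
    from 2[OF this] obtain \<phi> p2' where 3: "iso_mor \<C> B2 (B1 \<boxplus>\<^bsub>\<C>\<^esub> B3) \<phi>" "\<phi> \<cdot>\<^bsub>\<C>\<^esub> fB = in1 \<C> B1 B3"
      "pr2 \<C> B1 B3 \<cdot>\<^bsub>\<C>\<^esub> \<phi> = gB" "p2' \<cdot>\<^bsub>\<C>\<^esub> \<phi> = p2" "is_etri \<C> (Tri A2 (\<phi> \<cdot>\<^bsub>\<C>\<^esub> i2) (B1 \<boxplus>\<^bsub>\<C>\<^esub> B3) p2' C2 \<epsilon>2)"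
      "homotopic_mor \<C> (Tri A1 fA A2 gA A3 \<delta>A)
        (Tri B1 (in1 \<C> B1 B3) (B1 \<boxplus>\<^bsub>\<C>\<^esub> B3) (pr2 \<C> B1 B3) B3 \<delta>B) i1 (\<phi> \<cdot>\<^bsub>\<C>\<^esub> i2) i3"
      "diagram_3x3 \<C> (Tri A1 fA A2 gA A3 \<delta>A)
        (Tri B1 (in1 \<C> B1 B3) (B1 \<boxplus>\<^bsub>\<C>\<^esub> B3) (pr2 \<C> B1 B3) B3 \<delta>B) (Tri C1 fC C2 gC C3 \<delta>C)
        (Tri A1 i1 B1 p1 C1 \<epsilon>1) (Tri A2 (\<phi> \<cdot>\<^bsub>\<C>\<^esub> i2) (B1 \<boxplus>\<^bsub>\<C>\<^esub> B3) p2' C2 \<epsilon>2) (Tri A3 i3 B3 p3 C3 \<epsilon>3)"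
      by blast
    have 4: "inflation \<C> A2 B2 i2" "inflation \<C> A2 (B1 \<boxplus>\<^bsub>\<C>\<^esub> B3) (\<phi> \<cdot>\<^bsub>\<C>\<^esub> i2)"
      using 1(1) 3(5) unfolding inflation_def by blast+
    note 5 = 3(6,7)[unfolded conjunct2[OF *]]
    show ?Q
      by (rule exI[of _ i2], rule exI[of _ p2], rule exI[of _ \<phi>], rule exI[of _ "\<phi> \<cdot>\<^bsub>\<C>\<^esub> i2"], rule exI[of _ p2'], rule exI[of _ fC], rule exI[of _ gC], rule exI[of _ \<delta>C], rule exI[of _ p1], rule exI[of _ p3], rule exI[of _ \<epsilon>1], rule exI[of _ \<epsilon>2], rule exI[of _ \<epsilon>3], rule exI[of _ C1], rule exI[of _ C2], rule exI[of _ C3])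
        (intro conjI; (rule refl | fact 4 | fact 1 | fact 3 | fact 5))
  qed
qed

end
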